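(* Given a metric ATSP instance $G$ on $n$ vertices together with a minimum spanning arborescence $A$ of $G$, a tour of cost at most $3\,c^*(G)$ can be computed in time $\mathcal{O}(2^{k}k^2+n^2)$, where $k$ is the number of one-way edges in $A$.
   Context: Metric ATSP: given a simple complete directed graph $G=(V,E,c)$ with non-negative edge costs satisfying $c(u,v)+c(v,w)\ge c(u,w)$ for all $u,v,w\in V$, find a minimum-cost tour (directed cycle visiting every vertex exactly once); $c^*(G)$ is the optimal cost. A spanning arborescence of $G$ is a spanning directed tree with a root from which every vertex is reachable along the tree's directed edges; a minimum spanning arborescence is one of minimum total edge cost. An edge $(u,v)$ is a one-way edge if $c(u,v)<c(v,u)$. *)

theory Defs
  imports "Graph_Theory.Graph_Theory"
begin

section \<open>Metric ATSP\<close>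

text \<open>The vertices are numbered \<open>0, ..., n - 1\<close>, so that an instance can be handed to a machine.
  Costs are attached to arcs only, hence the triangle inequality is required for pairwise distinct
  vertices; nothing is assumed about the value of \<open>c\<close> on the diagonal.\<close>

definition metric_atsp ::
  "nat \<Rightarrow> nat pair_pre_digraph \<Rightarrow> (nat \<times> nat) weight_fun \<Rightarrow> bool" where
  "metric_atsp n G c \<longleftrightarrow>
     complete_digraph n (with_proj G) \<and> pverts G = {..<n} \<and>
     (\<forall>e\<in>parcs G. 0 \<le> c e) \<and>
     (\<forall>u\<in>pverts G. \<forall>v\<in>pverts G. \<forall>w\<in>pverts G. distinct [u, v, w] \<longrightarrow>
        c (u, w) \<le> c (u, v) + c (v, w))"

text \<open>A tour is given by its list of arcs; \<open>cycle\<close> already says that no vertex is repeated.\<close>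

definition tour :: "'a pair_pre_digraph \<Rightarrow> ('a \<times> 'a) list \<Rightarrow> bool" where
  "tour G p \<longleftrightarrow> pre_digraph.cycle (with_proj G) p \<and> snd ` set p = pverts G"

definition opt_cost :: "'a pair_pre_digraph \<Rightarrow> ('a \<times> 'a) weight_fun \<Rightarrow> real" where
  "opt_cost G c = Min (wf_digraph.awalk_cost c ` {p. tour G p})"

text \<open>The predicate \<open>tree\<close> of the library is not usable here: \<open>forest\<close> only excludes directed cycles.
  The uniqueness of the walk from the root expresses that \<open>T\<close> is a directed tree.\<close>

definition spanning_arborescence :: "'a pair_pre_digraph \<Rightarrow> 'a pair_pre_digraph \<Rightarrow> bool" where
  "spanning_arborescence T G \<longleftrightarrow>
     spanning (with_proj T) (with_proj G) \<and>
     (\<exists>r\<in>pverts T. \<forall>v\<in>pverts T. \<exists>!p. pre_digraph.awalk (with_proj T) r p v)"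

definition min_spanning_arborescence ::
  "'a pair_pre_digraph \<Rightarrow> 'a pair_pre_digraph \<Rightarrow> ('a \<times> 'a) weight_fun \<Rightarrow> bool" where
  "min_spanning_arborescence T G c \<longleftrightarrow>
     spanning_arborescence T G \<and>
     (\<forall>T'. spanning_arborescence T' G \<longrightarrow> sum c (parcs T) \<le> sum c (parcs T'))"

definition one_way_arcs :: "('a \<times> 'a) weight_fun \<Rightarrow> 'a pair_pre_digraph \<Rightarrow> ('a \<times> 'a) set" where
  "one_way_arcs c T = {(u, v) \<in> parcs T. c (u, v) < c (v, u)}"


section \<open>Random access machines with real registers\<close>

text \<open>Running times are measured on a uniform-cost random access machine. It has registers and
  arrays for natural numbers (used for vertices, addresses and counters) and, separately, registers
  and arrays for real numbers (used for costs). Registers and arrays are named by natural numbers, so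
  a program uses only finitely many of them; arrays are unbounded. Deliberately, the arithmetic is
  restricted: natural numbers can only be added, subtracted (truncated at 0) and compared, real
  numbers can only be added, subtracted and compared, and no real number can be converted to a
  natural number. So unit cost cannot be abused by packing much data into one number and extracting
  it by multiplication, division or rounding.

  Programs are structured instead of using jumps, which affects the number of steps only by a
  constant factor.\<close>

record state =
  nreg :: "nat \<Rightarrow> nat"
  narr :: "nat \<Rightarrow> nat \<Rightarrow> nat"
  rreg :: "nat \<Rightarrow> real"
  rarr :: "nat \<Rightarrow> nat \<Rightarrow> real"

datatype instr =
    NConst nat nat        \<comment> \<open>\<open>x := m\<close>\<close>
  | NCopy nat nat         \<comment> \<open>\<open>x := y\<close>\<close>
  | NAdd nat nat nat      \<comment> \<open>\<open>x := y + z\<close>\<close>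
  | NSub nat nat nat      \<comment> \<open>\<open>x := y - z\<close>\<close>
  | NLoad nat nat nat     \<comment> \<open>\<open>x := a[y]\<close>\<close>
  | NStore nat nat nat    \<comment> \<open>\<open>a[x] := y\<close>\<close>
  | RCopy nat nat         \<comment> \<open>\<open>p := q\<close>\<close>
  | RAdd nat nat nat      \<comment> \<open>\<open>p := q + r\<close>\<close>
  | RSub nat nat nat      \<comment> \<open>\<open>p := q - r\<close>\<close>
  | RLoad nat nat nat     \<comment> \<open>\<open>p := a[x]\<close>\<close>
  | RStore nat nat nat    \<comment> \<open>\<open>a[x] := p\<close>\<close>

datatype test =
    NEq nat nat
  | NLess nat nat
  | RLess nat nat

datatype com =
    Instr instr
  | Seq com com
  | If test com com
  | While test com

fun exec_instr :: "instr \<Rightarrow> state \<Rightarrow> state" where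
  "exec_instr (NConst x m) s = s\<lparr>nreg := (nreg s)(x := m)\<rparr>"
| "exec_instr (NCopy x y) s = s\<lparr>nreg := (nreg s)(x := nreg s y)\<rparr>"
| "exec_instr (NAdd x y z) s = s\<lparr>nreg := (nreg s)(x := nreg s y + nreg s z)\<rparr>"
| "exec_instr (NSub x y z) s = s\<lparr>nreg := (nreg s)(x := nreg s y - nreg s z)\<rparr>"
| "exec_instr (NLoad x a y) s = s\<lparr>nreg := (nreg s)(x := narr s a (nreg s y))\<rparr>"
| "exec_instr (NStore a x y) s =
     s\<lparr>narr := (narr s)(a := (narr s a)(nreg s x := nreg s y))\<rparr>"
| "exec_instr (RCopy p q) s = s\<lparr>rreg := (rreg s)(p := rreg s q)\<rparr>"
| "exec_instr (RAdd p q r) s = s\<lparr>rreg := (rreg s)(p := rreg s q + rreg s r)\<rparr>"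
| "exec_instr (RSub p q r) s = s\<lparr>rreg := (rreg s)(p := rreg s q - rreg s r)\<rparr>"
| "exec_instr (RLoad p a x) s = s\<lparr>rreg := (rreg s)(p := rarr s a (nreg s x))\<rparr>"
| "exec_instr (RStore a x p) s =
     s\<lparr>rarr := (rarr s)(a := (rarr s a)(nreg s x := rreg s p))\<rparr>"

fun eval_test :: "test \<Rightarrow> state \<Rightarrow> bool" where
  "eval_test (NEq x y) s \<longleftrightarrow> nreg s x = nreg s y"
| "eval_test (NLess x y) s \<longleftrightarrow> nreg s x < nreg s y"
| "eval_test (RLess p q) s \<longleftrightarrow> rreg s p < rreg s q"

text \<open>\<open>exec P s t s'\<close>: started in \<open>s\<close>, program \<open>P\<close> halts in \<open>s'\<close> after \<open>t\<close> steps, where every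
  executed instruction and every evaluated test counts as one step.\<close>

inductive exec :: "com \<Rightarrow> state \<Rightarrow> nat \<Rightarrow> state \<Rightarrow> bool" where
  Instr: "exec (Instr i) s 1 (exec_instr i s)"
| Seq: "exec P s t s' \<Longrightarrow> exec Q s' t' s'' \<Longrightarrow> exec (Seq P Q) s (t + t') s''"
| IfTrue: "eval_test b s \<Longrightarrow> exec P s t s' \<Longrightarrow> exec (If b P Q) s (1 + t) s'"
| IfFalse: "\<not> eval_test b s \<Longrightarrow> exec Q s t s' \<Longrightarrow> exec (If b P Q) s (1 + t) s'"
| WhileFalse: "\<not> eval_test b s \<Longrightarrow> exec (While b P) s 1 s"
| WhileTrue: "eval_test b s \<Longrightarrow> exec P s t s' \<Longrightarrow> exec (While b P) s' t' s'' \<Longrightarrow>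
    exec (While b P) s (1 + t + t') s''"

lemma exec_deterministic:
  assumes "exec P s t s'" and "exec P s t2 s2"
  shows "t2 = t \<and> s2 = s'"
  using assms
proof (induction arbitrary: t2 s2)
  case (Instr i s)
  then show ?case by (auto elim: exec.cases)
next
  case (Seq P s t s' Q t' s'')
  from Seq.prems show ?case by (cases rule: exec.cases) (use Seq.IH in blast)
next
  case (IfTrue b s P t s' Q)
  from IfTrue.prems show ?case by (cases rule: exec.cases) (use IfTrue in blast)+
next
  case (IfFalse b s Q t s' P)
  from IfFalse.prems show ?case by (cases rule: exec.cases) (use IfFalse in blast)+
next
  case (WhileFalse b s P)
  from WhileFalse.prems show ?case by (cases rule: exec.cases) (use WhileFalse in auto)
next
  case (WhileTrue b s P t s' t' s'')
  from WhileTrue.prems show ?case by (cases rule: exec.cases) (use WhileTrue in blast)+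
qed


section \<open>Input and output\<close>

text \<open>Register 0 holds \<open>n\<close>, real array 0 holds the cost matrix and natural number array 0 the adjacency
  matrix of \<open>A\<close>, both in row-major order. All other registers and cells are 0.\<close>

definition input_state ::
  "nat \<Rightarrow> nat pair_pre_digraph \<Rightarrow> (nat \<times> nat) weight_fun \<Rightarrow> nat pair_pre_digraph \<Rightarrow> state" where
  "input_state n G c A = \<lparr>
     nreg = (\<lambda>_. 0)(0 := n),
     narr = (\<lambda>_ _. 0)(0 := (\<lambda>i. if i < n * n \<and> (i div n, i mod n) \<in> parcs A then 1 else 0)),
     rreg = (\<lambda>_. 0),
     rarr = (\<lambda>_ _. 0)(0 :=
       (\<lambda>i. if i < n * n \<and> (i div n, i mod n) \<in> parcs G then c (i div n, i mod n) else 0))\<rparr>"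

text \<open>The result is read off the first \<open>n\<close> cells of natural number array 1, which list the vertices in the
  order in which the tour visits them; the last arc leads back to the first vertex.\<close>

definition output_tour :: "nat \<Rightarrow> state \<Rightarrow> (nat \<times> nat) list" where
  "output_tour n s = (let vs = map (narr s 1) [0..<n] in zip vs (rotate1 vs))"

end

theory Submission
  imports Defs "HOL-Library.Nat_Bijection"
begin

text \<open>
  Remove the one-way arcs from the arborescence \<open>A\<close>. The remaining arcs \<open>(u, v)\<close> satisfy
  \<open>c (v, u) \<le> c (u, v)\<close> and form a forest with \<open>k + 1\<close> roots. The Held-Karp recursion finds an optimal
  cycle through the roots in time \<open>O(2^k k^2)\<close>; short-cutting an optimal tour shows that it costs at
  most \<open>c^*\<close>. Every other vertex \<open>v\<close> is then inserted into the cycle directly after its parent \<open>u\<close>,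
  parents before children. If \<open>w\<close> was the successor of \<open>u\<close>, this adds
  \<open>c (u, v) + c (v, w) - c (u, w) \<le> c (u, v) + c (v, u) \<le> 2 c (u, v)\<close>, so the insertions add at most
  \<open>2 c (A)\<close> in total. Finally \<open>c (A) \<le> c^*\<close>, because a tour without its last arc is an arborescence.
\<close>

section \<open>Costs of closed walks and linked cycles\<close>

text \<open>For a one-way arc \<open>c (v, u)\<close> is not bounded by \<open>c (u, v)\<close>, so
  the cheap insertion fails exactly there and the heads of these arcs have to be placed by exact
  search. Keeping one of the k + 1 roots as a fixed depot leaves only k of them in the subsets: 2^k
  (k + 1) table entries, each found by O(k) comparisons. For k = 0 the term 2^k k^2 vanishes, and
  the constant work left over is charged to n^2. The machine can neither multiply nor divide. Row
  addresses, powers of two and subset codes are therefore built up by additions, and membership in a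
  subset is decided by comparing remainders, from the highest element downwards. The order "parents
  before children" is obtained without sorting the forest: n sweeps over all vertices insert
  whatever has its parent on the cycle already, which stays within O(n^2).\<close>

fun path_cost :: "('a \<Rightarrow> 'a \<Rightarrow> real) \<Rightarrow> 'a \<Rightarrow> 'a list \<Rightarrow> 'a \<Rightarrow> real" where
  "path_cost d x [] y = d x y"
| "path_cost d x (z # zs) y = d x z + path_cost d z zs y"

lemma path_cost_append:
  "path_cost d x (xs @ z # ys) y = path_cost d x xs z + path_cost d z ys y"
  by (induction xs arbitrary: x) auto

lemma path_cost_rotate:
  "path_cost d z (ys @ x # xs) z = path_cost d x (xs @ z # ys) x"
  by (simp add: path_cost_append)

lemma path_cost_zip: "path_cost d x xs y = (\<Sum>(a, b)\<leftarrow>zip (x # xs) (xs @ [y]). d a b)"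
  by (induction xs arbitrary: x) auto

lemma path_cost_map: "path_cost d (f x) (map f xs) (f y) = path_cost (\<lambda>a b. d (f a) (f b)) x xs y"
  by (induction xs arbitrary: x) auto

lemma path_cost_skip:
  assumes tri: "\<And>u v w. u \<in> V \<Longrightarrow> v \<in> V \<Longrightarrow> w \<in> V \<Longrightarrow> d u w \<le> d u v + d v w"
    and "x \<in> V" "z \<in> V" "set zs \<subseteq> V" "y \<in> V"
  shows "path_cost d x zs y \<le> d x z + path_cost d z zs y"
  using assms(2-5) tri[of x z y] tri[of x z "hd zs"] by (cases zs) auto

lemma path_cost_filter:
  assumes tri: "\<And>u v w. u \<in> V \<Longrightarrow> v \<in> V \<Longrightarrow> w \<in> V \<Longrightarrow> d u w \<le> d u v + d v w"
    and "x \<in> V" "set zs \<subseteq> V" "y \<in> V"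
  shows "path_cost d x (filter P zs) y \<le> path_cost d x zs y"
  using assms(2,3)
proof (induction zs arbitrary: x)
  case (Cons z zs)
  have "set (filter P zs) \<subseteq> V"
    using Cons.prems by auto
  then have "path_cost d x (filter P zs) y \<le> d x z + path_cost d z (filter P zs) y"
    using Cons.prems assms(4) by (intro path_cost_skip[OF tri]) auto
  with Cons.IH[of z] Cons.prems show ?case by auto
qed auto

text \<open>Mirrors the successor array of the program, where inserting a vertex takes two writes. A
  single vertex with \<open>nx r = r\<close> counts as a cycle; this is the case of only one
  root.\<close>

definition linked :: "('a \<Rightarrow> 'a) \<Rightarrow> 'a \<Rightarrow> 'a list \<Rightarrow> bool" where
  "linked nx r xs \<longleftrightarrow> distinct (r # xs) \<and> map nx (r # xs) = xs @ [r]"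

text \<open>Cut the cycle behind \<open>u\<close>. If \<open>u\<close> is the base point,
  \<open>v\<close> becomes the head of the list; otherwise it goes between the two pieces, whose
  other successors do not change.\<close>

lemma linked_insert:
  assumes "linked nx r xs" "u \<in> set (r # xs)" "v \<notin> set (r # xs)"
  obtains ys where "linked (nx(v := nx u, u := v)) r ys" "set (r # ys) = insert v (set (r # xs))"
proof -
  obtain as bs where ab: "r # xs = as @ u # bs"
    using assms(2) by (meson split_list)
  have upd: "map (nx(v := nx u, u := v)) zs = map nx zs" if "u \<notin> set zs" "v \<notin> set zs" for zs
    using that by (intro map_cong) auto
  show ?thesis
  proof (cases as)
    case Nil
    then show ?thesis
      using ab assms upd[of xs] by (intro that[of "v # xs"]) (auto simp: linked_def)
  next
    case (Cons a as')
    \<comment> \<open>Both sides split after the same number of entries, so the equation separates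
      into the part leading to \<open>u\<close> and the part leading back to
      \<open>r\<close>.\<close>
    have "map nx (r # as') @ nx u # map nx bs = (as' @ [u]) @ (bs @ [r])"
      using assms(1) ab Cons by (auto simp: linked_def)
    then have m: "map nx (r # as') = as' @ [u]" "nx u # map nx bs = bs @ [r]"
      by (subst (asm) append_eq_append_conv; simp)+
    show ?thesis
      using ab assms Cons m
        upd[of "r # as'"] upd[of bs]
      by (intro that[of "as' @ u # v # bs"]) (auto simp: linked_def)
  qed
qed

lemma linked_nth:
  assumes "linked nx r xs" "i \<le> length xs"
  shows "(nx ^^ i) r = (r # xs) ! i"
  using assms(2)
proof (induction i)
  case (Suc i)
  have "nx ((r # xs) ! i) = map nx (r # xs) ! i"
    using Suc.prems by (subst nth_map) auto
  also have "\<dots> = (xs @ [r]) ! i"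
    using assms(1) by (simp only: linked_def)
  also have "\<dots> = xs ! i"
    using Suc.prems by (simp add: nth_append)
  finally show ?case
    using Suc by simp
qed simp

text \<open>A sum over the vertex set forgets the order of the list, so that an insertion affects
  only the terms of \<open>u\<close> and \<open>v\<close>.\<close>

lemma linked_cost:
  assumes "linked nx r xs"
  shows "path_cost d r xs r = (\<Sum>x\<in>set (r # xs). d x (nx x))"
proof -
  have "path_cost d r xs r = (\<Sum>(a, b)\<leftarrow>zip (r # xs) (map nx (r # xs)). d a b)"
    using assms by (simp only: path_cost_zip linked_def)
  also have "\<dots> = (\<Sum>x\<leftarrow>r # xs. d x (nx x))"
    by (simp add: zip_map2 zip_same_conv_map comp_def)
  also have "\<dots> = (\<Sum>x\<in>set (r # xs). d x (nx x))"
    using assms by (subst sum_list_distinct_conv_sum_set) (auto simp: linked_def)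
  finally show ?thesis .
qed

lemma linked_insert_cost:
  fixes d :: "'a \<Rightarrow> 'a \<Rightarrow> real"
  assumes "finite S" "u \<in> S" "v \<notin> S"
  shows "(\<Sum>x\<in>insert v S. d x ((nx(v := nx u, u := v)) x)) =
     (\<Sum>x\<in>S. d x (nx x)) - d u (nx u) + d u v + d v (nx u)"
proof -
  have uv: "u \<noteq> v" using assms by auto
  have "(\<Sum>x\<in>S - {u}. d x ((nx(v := nx u, u := v)) x)) = (\<Sum>x\<in>S - {u}. d x (nx x))"
    using assms by (intro sum.cong) auto
  then show ?thesis
    using assms uv by (simp add: sum.remove[of S u])
qed

lemma pcas_zip: "pcas x (zip (x # xs) (xs @ [y])) y"
  by (induction xs arbitrary: x) auto

text \<open>Needed because the graph has no loops; the third hypothesis excludes the one-vertex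
  cycle, whose only arc is a loop.\<close>

lemma zip_shift_neq:
  assumes "distinct (x # xs)" "y \<notin> set xs" "xs \<noteq> [] \<or> x \<noteq> y" "(a, b) \<in> set (zip (x # xs) (xs @ [y]))"
  shows "a \<noteq> b"
  using assms
proof (induction xs arbitrary: x)
  case (Cons z zs)
  then show ?case by (cases "a = x \<and> b = z") auto
qed auto

lemma map_snd_pawalk: "pcas u p w \<Longrightarrow> pawalk_verts u p = u # map snd p"
  by (induction p arbitrary: u) auto

lemma pcas_path_cost:
  "pcas u (p @ [e]) w \<Longrightarrow> sum_list (map c (p @ [e])) = path_cost (\<lambda>x y. c (x, y)) u (map snd p) w"
proof (induction p arbitrary: u)
  case Nil
  then show ?case by (cases e) auto
next
  case (Cons a p)
  then show ?case by (cases a) auto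
qed

lemma pcas_append: "pcas u (p @ [e]) w \<longleftrightarrow> pcas u p (fst e) \<and> w = snd e"
  by (induction p arbitrary: u) auto

text \<open>Walks are compared from their ends: the last arc is determined by its head, and since no
  arc enters \<open>r\<close>, neither walk can be a proper suffix of the other.\<close>

lemma unique_pcas:
  assumes "\<And>a b v. (a, v) \<in> E \<Longrightarrow> (b, v) \<in> E \<Longrightarrow> a = b" and root: "\<And>a. (a, r) \<notin> E"
    and "set p \<subseteq> E" "set q \<subseteq> E" "pcas r p v" "pcas r q v"
  shows "p = q"
  using assms(3-6)
proof (induction p arbitrary: q v rule: rev_induct)
  case Nil
  then have "v = r" by simp
  with Nil root show ?case
    by (cases q rule: rev_cases) (auto simp: pcas_append simp flip: surjective_pairing)
next
  case (snoc e p)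
  have v: "v = snd e" using snoc.prems by (simp add: pcas_append)
  have "q \<noteq> []"
    using snoc.prems root v by (auto, metis prod.collapse)
  then obtain q' e' where q: "q = q' @ [e']" by (metis rev_exhaust)
  have "snd e' = snd e" "e \<in> E" "e' \<in> E"
    using snoc.prems q by (auto simp: pcas_append)
  then have "e' = e"
    using assms(1) by (metis prod.collapse)
  then show ?case
    using snoc q by (auto simp: pcas_append)
qed

section \<open>The Held-Karp recursion\<close>

lemma set_decode_less: "i \<in> set_decode S \<Longrightarrow> S < 2 ^ k \<Longrightarrow> i < k"
proof (rule ccontr)
  assume i: "i \<in> set_decode S" and S: "S < 2 ^ k" and "\<not> i < k"
  then have "(2::nat) ^ k \<le> 2 ^ i" by (intro power_increasing) auto
  with S have "S div 2 ^ i = 0" by (intro div_less) linarith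
  with i show False by (simp add: set_decode_def)
qed

text \<open>The encoding is additive on disjoint sets, so deleting an element is a single
  subtraction, which the machine can do.\<close>

lemma set_decode_remove:
  assumes "i \<in> set_decode S"
  shows "2 ^ i \<le> S" "set_decode (S - 2 ^ i) = set_decode S - {i}"
proof -
  have "S = set_encode (insert i (set_decode S - {i}))"
    using assms by (simp add: insert_absorb)
  also have "\<dots> = 2 ^ i + set_encode (set_decode S - {i})"
    by (subst set_encode_insert) auto
  finally have "S = 2 ^ i + set_encode (set_decode S - {i})" .
  then show "2 ^ i \<le> S" "set_decode (S - 2 ^ i) = set_decode S - {i}"
    by (metis le_add1, metis add_diff_cancel_left' finite_Diff finite_set_decode set_encode_inverse)
qed

lemma set_decode_full: "set_decode (2 ^ k - 1) = {..<k}"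
proof -
  have "set_encode {..<k} = 2 ^ k - 1"
    unfolding set_encode_def by (simp add: lessThan_atLeast0 sum_power2)
  then show ?thesis
    by (metis finite_lessThan set_encode_inverse)
qed

text \<open>This is the bit test without division: bit \<open>i\<close> is set iff the remainder
  modulo \<open>2 ^ Suc i\<close> is at least \<open>2 ^ i\<close>, and subtracting
  \<open>2 ^ i\<close> then gives the next remainder. For this reason the inner Held-Karp loop runs
  downwards.\<close>

lemma mod_power2_Suc:
  "(S::nat) mod 2 ^ Suc i = (if i \<in> set_decode S then 2 ^ i else 0) + S mod 2 ^ i"
proof -
  have "S mod 2 ^ Suc i = 2 ^ i * (S div 2 ^ i mod 2) + S mod 2 ^ i"
    unfolding power_Suc2 by (rule mod_mult2_eq)
  then show ?thesis
    by (simp add: set_decode_def odd_iff_mod_2_eq_one even_iff_mod_2_eq_zero)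
qed

text \<open>Subsets of \<open>{..<k}\<close> are coded as numbers by \<open>set_decode\<close>, and \<open>k\<close> is the depot: \<open>D S j\<close> is the least
  cost of a path from \<open>j\<close> through all of \<open>S\<close> to \<open>k\<close>. The relation \<open>hk_best\<close> describes the intermediate
  result \<open>x\<close> with minimiser \<open>b\<close> after the elements \<open>i \<ge> l\<close> of \<open>S\<close> have been tried as first vertex; here
  \<open>b = k\<close> marks that there was no candidate yet, so that for \<open>S = 0\<close> the initial value \<open>d j k\<close> remains.\<close>

definition hk_best :: "(nat \<Rightarrow> nat \<Rightarrow> real) \<Rightarrow> nat \<Rightarrow> (nat \<Rightarrow> nat \<Rightarrow> real) \<Rightarrow> nat \<Rightarrow> nat \<Rightarrow> nat \<Rightarrow> real \<Rightarrow> nat \<Rightarrow> bool"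
  where "hk_best d k D S j l x b \<longleftrightarrow>
    (if \<forall>i\<in>set_decode S. i < l then b = k \<and> x = d j k
     else b \<in> set_decode S \<and> x = d j b + D (S - 2 ^ b) b \<and>
       (\<forall>i\<in>set_decode S. l \<le> i \<longrightarrow> x \<le> d j i + D (S - 2 ^ i) i))"

definition hk_row :: "(nat \<Rightarrow> nat \<Rightarrow> real) \<Rightarrow> nat \<Rightarrow> (nat \<Rightarrow> nat \<Rightarrow> real) \<Rightarrow> (nat \<Rightarrow> nat \<Rightarrow> nat) \<Rightarrow> nat \<Rightarrow> bool"
  where "hk_row d k D B S \<longleftrightarrow> (\<forall>j\<le>k. hk_best d k D S j 0 (D S j) (B S j))"

text \<open>Peel off the first vertex of the path. This is one half of optimality; that the value is
  attained follows from the cycle traced along the minimisers in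
  \<open>hk_trace_finish\<close>.\<close>

lemma hk_lower_bound:
  assumes rows: "\<And>S. S < 2 ^ k \<Longrightarrow> hk_row d k D B S"
    and "S < 2 ^ k" "j \<le> k" "distinct xs" "set xs = set_decode S"
  shows "D S j \<le> path_cost d j xs k"
  using assms(2-5)
proof (induction xs arbitrary: S j)
  case Nil
  then show ?case using rows[of S] by (auto simp: hk_row_def hk_best_def)
next
  case (Cons i xs)
  have i: "i \<in> set_decode S" using Cons.prems by auto
  have "D S j \<le> d j i + D (S - 2 ^ i) i"
    using rows[of S] Cons.prems i by (auto simp: hk_row_def hk_best_def split: if_splits)
  also have "D (S - 2 ^ i) i \<le> path_cost d i xs k"
    using Cons.prems set_decode_remove[OF i] set_decode_less[OF i]
    by (intro Cons.IH) (auto intro: order.strict_implies_order)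
  finally show ?case by simp
qed

lemma hk_argmin:
  assumes "hk_row d k D B S" "j \<le> k" "S \<noteq> 0"
  shows "B S j \<in> set_decode S" "D S j = d j (B S j) + D (S - 2 ^ B S j) (B S j)"
proof -
  have "set_decode S \<noteq> {}"
    using assms(3) by (metis set_decode_inverse set_encode_empty)
  then show "B S j \<in> set_decode S" "D S j = d j (B S j) + D (S - 2 ^ B S j) (B S j)"
    using assms by (auto simp: hk_row_def hk_best_def split: if_splits)
qed

text \<open>One statement for each outcome of the inner loop body. There is no infinite starting
  value, so the first candidate is accepted unconditionally; \<open>b = k\<close> can mark this
  situation because all elements of a set with code below \<open>2 ^ k\<close> are smaller than
  \<open>k\<close>.\<close>

lemma hk_best_step:
  assumes "hk_best d k D S j (Suc l) x b" "S < 2 ^ k"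
  shows "l \<notin> set_decode S \<Longrightarrow> hk_best d k D S j l x b"
    and "l \<in> set_decode S \<Longrightarrow> b = k \<or> d j l + D (S - 2 ^ l) l < x \<Longrightarrow>
      hk_best d k D S j l (d j l + D (S - 2 ^ l) l) l"
    and "l \<in> set_decode S \<Longrightarrow> b \<noteq> k \<Longrightarrow> \<not> d j l + D (S - 2 ^ l) l < x \<Longrightarrow> hk_best d k D S j l x b"
proof -
  have bk: "b = k \<longleftrightarrow> (\<forall>i\<in>set_decode S. i < Suc l)"
    using assms set_decode_less[OF _ assms(2)] by (auto simp: hk_best_def split: if_splits)
  let ?c = "\<lambda>i. d j i + D (S - 2 ^ i) i"
  have lower: "x \<le> ?c i" if "i \<in> set_decode S" "l < i" for i
    using assms(1) that by (auto simp: hk_best_def split: if_splits)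
  have arg: "b \<in> set_decode S" "x = ?c b" if "b \<noteq> k"
    using assms(1) that by (auto simp: hk_best_def split: if_splits)
  show "hk_best d k D S j l x b" if l: "l \<notin> set_decode S"
  proof -
    have "(\<forall>i\<in>set_decode S. i < Suc l) \<longleftrightarrow> (\<forall>i\<in>set_decode S. i < l)"
      using l by (metis less_Suc_eq)
    moreover have "(\<forall>i\<in>set_decode S. Suc l \<le> i \<longrightarrow> x \<le> ?c i) \<longleftrightarrow>
        (\<forall>i\<in>set_decode S. l \<le> i \<longrightarrow> x \<le> ?c i)"
      using l by (metis Suc_leD Suc_leI le_neq_implies_less)
    ultimately show ?thesis
      using assms(1) unfolding hk_best_def by presburger
  qed
  show "hk_best d k D S j l (?c l) l" if l: "l \<in> set_decode S" "b = k \<or> ?c l < x"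
  proof -
    have "?c l \<le> ?c i" if i: "i \<in> set_decode S" "l \<le> i" for i
    proof (cases "i = l")
      case False
      with i have "l < i" by simp
      then have "b \<noteq> k" using bk i(1) by (meson not_less_eq)
      with l lower[OF i(1) \<open>l < i\<close>] show ?thesis by simp
    qed simp
    moreover have "\<not> (\<forall>i\<in>set_decode S. i < l)" using l(1) by blast
    ultimately show ?thesis
      using l(1) by (auto simp: hk_best_def)
  qed
  show "hk_best d k D S j l x b" if l: "l \<in> set_decode S" "b \<noteq> k" "\<not> ?c l < x"
  proof -
    have "x \<le> ?c i" if i: "i \<in> set_decode S" "l \<le> i" for i
      using lower[OF i(1)] l(3) i(2) by (cases "i = l") auto
    moreover have "\<not> (\<forall>i\<in>set_decode S. i < l)" using l(1) by blast
    ultimately show ?thesis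
      using arg[OF l(2)] by (auto simp: hk_best_def)
  qed
qed

text \<open>Deleting an element lowers the code, so an entry depends only on rows with smaller
  codes. Subsets can thus be treated in numerical order, and later writes do not disturb finished
  rows.\<close>

lemma hk_best_cong:
  assumes "S < 2 ^ k" "\<And>T i. T < S \<Longrightarrow> i < k \<Longrightarrow> D T i = D' T i"
  shows "hk_best d k D S j l x b \<longleftrightarrow> hk_best d k D' S j l x b"
proof -
  have "D (S - 2 ^ i) i = D' (S - 2 ^ i) i" if "i \<in> set_decode S" for i
  proof (rule assms(2))
    have "(0::nat) < 2 ^ i" by simp
    then show "S - 2 ^ i < S"
      using set_decode_remove(1)[OF that] by (intro diff_less) linarith+
    show "i < k" by (rule set_decode_less[OF that assms(1)])
  qed
  then show ?thesis
    unfolding hk_best_def by (intro if_cong conj_cong ball_cong) auto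
qed


section \<open>Tours and arborescences\<close>

text \<open>With 0 on the diagonal the triangle inequality holds without a distinctness condition;
  these are also exactly the entries of the input matrix.\<close>

definition arc_cost :: "nat \<Rightarrow> (nat \<times> nat) weight_fun \<Rightarrow> nat \<Rightarrow> nat \<Rightarrow> real" where
  "arc_cost n c u v = (if u < n \<and> v < n \<and> u \<noteq> v then c (u, v) else 0)"

lemma metric_atspD:
  assumes "metric_atsp n G c"
  shows "pverts G = {..<n}" "parcs G = {(u, v). u < n \<and> v < n \<and> u \<noteq> v}"
    and "wf_digraph (with_proj G)" "fin_digraph (with_proj G)"
    and "arc_cost n c u u = 0" "0 \<le> arc_cost n c u v"
    and "u < n \<Longrightarrow> v < n \<Longrightarrow> w < n \<Longrightarrow> arc_cost n c u w \<le> arc_cost n c u v + arc_cost n c v w"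
proof -
  have "complete_digraph n (with_proj G)" and V: "pverts G = {..<n}"
    using assms by (auto simp: metric_atsp_def)
  then interpret graph "with_proj G" by (simp add: complete_digraph_def)
  show "wf_digraph (with_proj G)" "fin_digraph (with_proj G)" by unfold_locales
  show "pverts G = {..<n}" by fact
  show E: "parcs G = {(u, v). u < n \<and> v < n \<and> u \<noteq> v}"
    using assms by (auto simp: metric_atsp_def complete_digraph_pair_def)
  show "arc_cost n c u u = 0" by (simp add: arc_cost_def)
  show nn: "0 \<le> arc_cost n c u v" for u v
    using assms E by (auto simp: arc_cost_def metric_atsp_def)
  assume "u < n" "v < n" "w < n"
  \<comment> \<open>If two of the vertices agree, then either \<open>u = w\<close> and the left side
    is 0, or one summand on the right is 0 and the other equals the left side.\<close>
  then show "arc_cost n c u w \<le> arc_cost n c u v + arc_cost n c v w"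
    using assms V nn[of u v] nn[of v u]
    by (cases "distinct [u, v, w]") (auto simp: arc_cost_def metric_atsp_def)
qed

text \<open>Appending an arc \<open>(u, v)\<close> to the unique walk to \<open>u\<close> gives a
  walk to \<open>v\<close>, hence the unique one. So its last arc determines the parent of
  \<open>v\<close>, and the length of the walk, used as \<open>dep\<close>, grows along
  arcs.\<close>

lemma arborescenceE:
  assumes G: "metric_atsp n G c" and A: "spanning_arborescence A G"
  obtains r dep where "r < n" "\<And>a. (a, r) \<notin> parcs A"
    and "\<And>a b v. (a, v) \<in> parcs A \<Longrightarrow> (b, v) \<in> parcs A \<Longrightarrow> a = b"
    and "\<And>v. v < n \<Longrightarrow> v \<noteq> r \<Longrightarrow> \<exists>u. (u, v) \<in> parcs A"
    and "\<And>u v. (u, v) \<in> parcs A \<Longrightarrow> dep u < dep v"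
    and "\<And>v. v < n \<Longrightarrow> dep v < (n::nat)"
proof -
  have AG: "pverts A = {..<n}" "parcs A \<subseteq> parcs G" and "wf_digraph (with_proj A)"
    using A metric_atspD[OF G] by (auto simp: spanning_arborescence_def spanning_def subgraph_def)
  then interpret wf_digraph "with_proj A" by simp
  have "finite (parcs G)"
    using fin_digraph.finite_arcs[OF metric_atspD(4)[OF G]] by simp
  then interpret fin_digraph "with_proj A"
    using AG by unfold_locales (auto intro: finite_subset)
  obtain r where r: "r < n" and ex1: "\<And>v. v < n \<Longrightarrow> \<exists>!p. awalk r p v"
    using A AG by (auto simp: spanning_arborescence_def)
  define W where "W v = (THE p. awalk r p v)" for v
  have W: "awalk r (W v) v" if "v < n" for v
    unfolding W_def using theI'[OF ex1[OF that]] .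
  have W_eq: "p = W v" if "awalk r p v" for p v
  proof -
    have "v < n" using that AG by auto
    then show ?thesis using that W ex1 by blast
  qed
  have W_arc: "W v = W u @ [(u, v)]" "u < n" "v < n" if "(u, v) \<in> parcs A" for u v
  proof -
    show uv: "u < n" "v < n"
      using that AG tail_in_verts[of "(u, v)"] head_in_verts[of "(u, v)"] by auto
    have "awalk r (W u @ [(u, v)]) v"
      using W[OF uv(1)] that uv AG by (auto simp: awalk_def cas_with_proj_eq pcas_append)
    then show "W v = W u @ [(u, v)]" using W_eq by metis
  qed
  have "W r = []"
    using W_eq[of "[]" r] r AG by (simp add: awalk_Nil_iff)
  show ?thesis
  proof (rule that[of r "\<lambda>v. length (W v)"])
    show "r < n" by fact
    show "(a, r) \<notin> parcs A" for a
      using W_arc(1)[of a r] \<open>W r = []\<close> by auto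
    show "a = b" if "(a, v) \<in> parcs A" "(b, v) \<in> parcs A" for a b v
      using W_arc(1)[OF that(1)] W_arc(1)[OF that(2)] by simp
    show "\<exists>u. (u, v) \<in> parcs A" if "v < n" "v \<noteq> r" for v
      using W[OF that(1)] that(2)
      by (cases "W v" rule: rev_cases) (auto simp: awalk_def cas_with_proj_eq pcas_append)
    show "length (W u) < length (W v)" if "(u, v) \<in> parcs A" for u v
      using W_arc(1)[OF that] by simp
    show "length (W v) < n" if "v < n" for v
    proof -
      \<comment> \<open>The unique walk coincides with its own reduction to a path, so it repeats no
        vertex and has fewer than \<open>n\<close> arcs.\<close>
      have "apath r (awalk_to_apath (W v)) v"
        using W[OF that] by (rule apath_awalk_to_apath)
      then have "apath r (W v) v"
        using W_eq awalkI_apath by metis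
      then show ?thesis using length_apath_less[of r "W v" v] AG by simp
    qed
  qed
qed

section \<open>Hamiltonian paths, tours and the optimum\<close>

lemma zip_shift_subset: "set (zip (x # xs) xs) \<subseteq> set (zip (x # xs) (xs @ [y]))"
proof (induction xs arbitrary: x)
  case (Cons z zs)
  then show ?case by (simp add: subset_insertI2)
qed simp

text \<open>Prefixes of the list provide the walks from \<open>r\<close>; distinctness bounds all
  in-degrees by one, which gives uniqueness by \<open>unique_pcas\<close>.\<close>

lemma path_arborescence:
  assumes G: "metric_atsp n G c" and xs: "distinct (r # xs)" "set (r # xs) = {..<n}"
  shows "spanning_arborescence \<lparr>pverts = {..<n}, parcs = set (zip (r # xs) xs)\<rparr> G"
    (is "spanning_arborescence ?T G")
proof -
  have E: "set (zip (r # xs) xs) \<subseteq> parcs G"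
  proof (clarify)
    fix a b assume ab: "(a, b) \<in> set (zip (r # xs) xs)"
    have "xs \<noteq> []" using ab by (cases xs) simp_all
    then have "a \<noteq> b"
      using zip_shift_neq[OF xs(1) _ _ subsetD[OF zip_shift_subset ab], of r] xs(1) by simp
    moreover have "a \<in> set (r # xs)" "b \<in> set (r # xs)"
      using set_zip_leftD[OF ab] set_zip_rightD[OF ab] by simp_all
    ultimately show "(a, b) \<in> parcs G"
      using xs(2) metric_atspD(2)[OF G] by auto
  qed
  have wf: "wf_digraph (with_proj ?T)"
    using E metric_atspD(2)[OF G] by unfold_locales auto
  have walk: "pcas x (zip (take i (x # zs)) (take i zs)) ((x # zs) ! i)"
    if "i \<le> length zs" for x :: nat and zs i
    using that
  proof (induction zs arbitrary: x i)
    case (Cons z zs)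
    then show ?case by (cases i) auto
  qed auto
  have "\<exists>!p. pre_digraph.awalk (with_proj ?T) r p v" if "v < n" for v
  proof (rule ex_ex1I)
    obtain i where i: "i \<le> length xs" "v = (r # xs) ! i"
      using \<open>v < n\<close> xs(2) by (metis in_set_conv_nth length_Cons less_Suc_eq_le lessThan_iff)
    have "set (zip (take i (r # xs)) (take i xs)) \<subseteq> set (zip (r # xs) xs)"
      using set_take_subset[of i "zip (r # xs) xs"] by (simp add: take_zip)
    then show "\<exists>p. pre_digraph.awalk (with_proj ?T) r p v"
      using walk[OF i(1), of r] i xs(2)
      by (intro exI[of _ "zip (take i (r # xs)) (take i xs)"])
        (auto simp: pre_digraph.awalk_def cas_with_proj_eq)
    fix p q
    assume p: "pre_digraph.awalk (with_proj ?T) r p v" and q: "pre_digraph.awalk (with_proj ?T) r q v"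
    show "p = q"
    proof (rule unique_pcas[of "set (zip (r # xs) xs)" r _ _ v])
      show "a = b" if "(a, w) \<in> set (zip (r # xs) xs)" "(b, w) \<in> set (zip (r # xs) xs)" for a b w
        using that xs(1) by (auto simp: in_set_zip nth_eq_iff_index_eq)
      show "(a, r) \<notin> set (zip (r # xs) xs)" for a
        using xs(1) by (auto dest: set_zip_rightD)
    qed (use p q in \<open>auto simp: pre_digraph.awalk_def cas_with_proj_eq\<close>)
  qed
  moreover have "r < n" using xs(2) by auto
  ultimately have "\<exists>r\<in>pverts ?T. \<forall>v\<in>pverts ?T. \<exists>!p. pre_digraph.awalk (with_proj ?T) r p v"
    by (intro bexI[of _ r] ballI) simp_all
  then show ?thesis
    using wf E metric_atspD(1,3)[OF G]
    unfolding spanning_arborescence_def spanning_def subgraph_def compatible_def by simp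
qed

text \<open>The base point is prescribed so that a tour can later be compared with the cycles
  through \<open>first_root\<close>; a tour based elsewhere is rotated.\<close>

lemma tour_vertices:
  assumes G: "metric_atsp n G c" and p: "tour G p" and "r < n"
  obtains xs where "distinct (r # xs)" "set (r # xs) = {..<n}"
    and "wf_digraph.awalk_cost c p = path_cost (arc_cost n c) r xs r"
proof -
  obtain u where u: "pcas u p u" "set p \<subseteq> parcs G" "distinct (map snd p)" "p \<noteq> []"
    using p by (auto simp: tour_def pre_digraph.cycle_def pre_digraph.awalk_def cas_with_proj_eq
      awalk_verts_with_proj_eq map_snd_pawalk)
  have Vp: "set (map snd p) = {..<n}"
    using p metric_atspD(1)[OF G] by (simp add: tour_def)
  obtain q e where q: "p = q @ [e]" using u(4) by (metis rev_exhaust)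
  have e: "snd e = u" using u(1) q by (simp add: pcas_append)
  have "sum_list (map c p) = sum_list (map (\<lambda>(x, y). arc_cost n c x y) p)"
    using u(2) metric_atspD(2)[OF G] by (intro arg_cong[of _ _ sum_list] map_cong) (auto simp: arc_cost_def)
  also have "\<dots> = path_cost (arc_cost n c) u (map snd q) u"
    using pcas_path_cost[of u q e u "\<lambda>(x, y). arc_cost n c x y"] u(1) q by simp
  finally have cost: "sum_list (map c p) = path_cost (arc_cost n c) u (map snd q) u" .
  have dist: "distinct (u # map snd q)" "set (u # map snd q) = {..<n}"
    using u(3) Vp q e by auto
  have ac: "wf_digraph.awalk_cost c p = sum_list (map c p)"
    by (rule wf_digraph.awalk_cost_def[OF metric_atspD(3)[OF G]])
  show ?thesis
  proof (cases "r = u")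
    case True
    then show ?thesis using that dist cost ac by metis
  next
    case False
    then have "r \<in> set (map snd q)" using dist(2) \<open>r < n\<close> by auto
    then obtain as bs where ab: "map snd q = as @ r # bs" by (meson split_list)
    show ?thesis
      using dist cost ac unfolding ab path_cost_rotate by (intro that[of "bs @ u # as"]) auto
  qed
qed

lemma tour_of_list:
  assumes G: "metric_atsp n G c" and "n \<ge> 2" and xs: "distinct (r # xs)" "set (r # xs) = {..<n}"
  shows "tour G (zip (r # xs) (xs @ [r]))"
    and "wf_digraph.awalk_cost c (zip (r # xs) (xs @ [r])) = path_cost (arc_cost n c) r xs r"
proof -
  let ?p = "zip (r # xs) (xs @ [r])"
  \<comment> \<open>With a single vertex the closed list would be a loop, which is not an arc of
    \<open>G\<close>; this is where \<open>n \<ge> 2\<close> enters.\<close>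
  have "xs \<noteq> []"
  proof
    assume "xs = []"
    with xs(2) have "card {..<n} = card {r}" by simp
    with \<open>n \<ge> 2\<close> show False by simp
  qed
  have ne: "a \<noteq> b \<and> a < n \<and> b < n" if "(a, b) \<in> set ?p" for a b
  proof -
    have "a \<in> set (r # xs)" "b \<in> set (r # xs)"
      using set_zip_leftD[OF that] set_zip_rightD[OF that] by auto
    then show ?thesis
      using zip_shift_neq[of r xs r a b] that xs \<open>xs \<noteq> []\<close> by auto
  qed
  have snd: "map snd ?p = xs @ [r]"
    by (subst map_snd_zip) auto
  have "set ?p \<subseteq> parcs G" using ne metric_atspD(2)[OF G] by auto
  moreover have "snd ` set ?p = {..<n}"
    using snd xs(2) by (metis list.set_map rotate1.simps(2) set_rotate1)
  moreover have "distinct (map snd ?p)" using snd xs(1) by auto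
  moreover have "r < n" using xs(2) by auto
  ultimately show "tour G ?p"
    using pcas_zip[of r xs r] metric_atspD(1)[OF G]
    by (auto simp: tour_def pre_digraph.cycle_def pre_digraph.awalk_def cas_with_proj_eq
      awalk_verts_with_proj_eq map_snd_pawalk intro!: exI[of _ r])
  have "sum_list (map c ?p) = (\<Sum>(a, b)\<leftarrow>?p. arc_cost n c a b)"
    using ne by (intro arg_cong[of _ _ sum_list] map_cong) (auto simp: arc_cost_def)
  then show "wf_digraph.awalk_cost c ?p = path_cost (arc_cost n c) r xs r"
    unfolding path_cost_zip using wf_digraph.awalk_cost_def[OF metric_atspD(3)[OF G]] by metis
qed

text \<open>\<open>Min\<close> is meaningful only on a finite nonempty set. The heads of a tour are
  distinct and cover all vertices, so every tour has exactly \<open>n\<close> arcs and there are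
  finitely many.\<close>

lemma opt_cost_attained:
  assumes G: "metric_atsp n G c" and "tour G p"
  obtains q where "tour G q" "opt_cost G c = wf_digraph.awalk_cost c q"
proof -
  have "length q = n" if "tour G q" for q
  proof -
    have "distinct (map snd q)" "set (map snd q) = {..<n}"
      using that metric_atspD(1)[OF G]
      by (auto simp: tour_def pre_digraph.cycle_def pre_digraph.awalk_def cas_with_proj_eq
        awalk_verts_with_proj_eq map_snd_pawalk)
    then show ?thesis
      by (metis card_lessThan distinct_card length_map)
  qed
  then have "{q. tour G q} \<subseteq> {q. set q \<subseteq> parcs G \<and> length q = n}"
    by (auto simp: tour_def pre_digraph.cycle_def pre_digraph.awalk_def)
  moreover have "finite (parcs G)"
    using fin_digraph.finite_arcs[OF metric_atspD(4)[OF G]] by simp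
  ultimately have "finite {q. tour G q}"
    using finite_lists_length_eq finite_subset by blast
  then have "opt_cost G c \<in> wf_digraph.awalk_cost c ` {q. tour G q}"
    unfolding opt_cost_def using assms(2) by (intro Min_in) auto
  then show ?thesis using that by auto
qed

lemma min_arborescence_le:
  assumes G: "metric_atsp n G c" and A: "min_spanning_arborescence A G c"
    and xs: "distinct (r # xs)" "set (r # xs) = {..<n}"
  shows "sum c (parcs A) \<le> path_cost (arc_cost n c) r xs r"
proof -
  let ?z = "zip (r # xs) xs"
  have "sum c (parcs A) \<le> sum c (set ?z)"
    using A path_arborescence[OF G xs] by (auto simp: min_spanning_arborescence_def)
  also have "sum c (set ?z) = (\<Sum>(a, b)\<in>set ?z. arc_cost n c a b)"
  proof (rule sum.cong)
    fix e assume e: "e \<in> set ?z"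
    then have e': "(fst e, snd e) \<in> set ?z" by simp
    have "xs \<noteq> []" using e by (cases xs) simp_all
    then have "fst e \<noteq> snd e"
      using zip_shift_neq[OF xs(1) _ _ subsetD[OF zip_shift_subset e'], of r] xs(1) by simp
    moreover have "fst e \<in> set (r # xs)" "snd e \<in> set (r # xs)"
      using set_zip_leftD[OF e'] set_zip_rightD[OF e'] by simp_all
    ultimately show "c e = (case e of (a, b) \<Rightarrow> arc_cost n c a b)"
      using xs(2) by (cases e) (auto simp: arc_cost_def)
  qed simp
  also have "\<dots> = (\<Sum>(a, b)\<leftarrow>?z. arc_cost n c a b)"
    using xs(1) by (subst sum_list_distinct_conv_sum_set) (auto simp: distinct_zipI2)
  also have "\<dots> \<le> (\<Sum>(a, b)\<leftarrow>zip (r # xs) (xs @ [r]). arc_cost n c a b)"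
  proof -
    have "(\<Sum>(a, b)\<leftarrow>zip (x # zs) zs. arc_cost n c a b)
        \<le> (\<Sum>(a, b)\<leftarrow>zip (x # zs) (zs @ [r]). arc_cost n c a b)" for x zs
      using metric_atspD(6)[OF G] by (induction zs arbitrary: x) auto
    then show ?thesis .
  qed
  finally show ?thesis by (simp add: path_cost_zip)
qed

section \<open>The forest of kept arcs\<close>

definition kept_arc :: "('a \<times> 'a) weight_fun \<Rightarrow> 'a pair_pre_digraph \<Rightarrow> 'a \<Rightarrow> 'a \<Rightarrow> bool" where
  "kept_arc c T u v \<longleftrightarrow> (u, v) \<in> parcs T \<and> \<not> c (u, v) < c (v, u)"

text \<open>The code of a parent \<open>u\<close> is \<open>Suc u\<close>; the code \<open>0\<close> marks a root.\<close>

definition parent_code :: "(nat \<times> nat) weight_fun \<Rightarrow> nat pair_pre_digraph \<Rightarrow> nat \<Rightarrow> nat" where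
  "parent_code c T v = (if \<exists>u. kept_arc c T u v then Suc (THE u. kept_arc c T u v) else 0)"

text \<open>Collects what the algorithm relies on. \<open>dep\<close> serves the analysis: it is any
  rank below \<open>n\<close> that increases from parent to child, and it bounds the number of
  insertion sweeps.\<close>

locale rooted_forest =
  fixes n :: nat and d :: "nat \<Rightarrow> nat \<Rightarrow> real" and par dep :: "nat \<Rightarrow> nat"
  assumes n_pos: "0 < n"
    and tri: "u < n \<Longrightarrow> v < n \<Longrightarrow> w < n \<Longrightarrow> d u w \<le> d u v + d v w"
    and par: "v < n \<Longrightarrow> par v = Suc u \<Longrightarrow> u < n \<and> dep u < dep v \<and> d v u \<le> d u v"
    and dep: "v < n \<Longrightarrow> dep v < n"

text \<open>The roots are the root of \<open>A\<close> and the heads of the one-way arcs. In-degree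
  at most one makes these heads distinct, and no arc enters the root of \<open>A\<close>, which
  gives the count. Kept arcs with different heads are different arcs of \<open>A\<close>, so
  nonnegativity bounds their cost.\<close>

lemma kept_forest:
  assumes G: "metric_atsp n G c" and A: "min_spanning_arborescence A G c"
  obtains dep where "rooted_forest n (arc_cost n c) (parent_code c A) dep"
    and "card {v. v < n \<and> parent_code c A v = 0} = Suc (card (one_way_arcs c A))"
    and "\<And>u v. kept_arc c A u v \<longleftrightarrow> parent_code c A v = Suc u"
    and "(\<Sum>v | v < n \<and> parent_code c A v \<noteq> 0. arc_cost n c (parent_code c A v - 1) v) \<le> sum c (parcs A)"
proof -
  have sA: "spanning_arborescence A G" using A by (simp add: min_spanning_arborescence_def)
  obtain r and dep :: "nat \<Rightarrow> nat" where r: "r < n" "\<And>a. (a, r) \<notin> parcs A"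
    and uniq: "\<And>a b v. (a, v) \<in> parcs A \<Longrightarrow> (b, v) \<in> parcs A \<Longrightarrow> a = b"
    and ex: "\<And>v. v < n \<Longrightarrow> v \<noteq> r \<Longrightarrow> \<exists>u. (u, v) \<in> parcs A"
    and dep: "\<And>u v. (u, v) \<in> parcs A \<Longrightarrow> dep u < dep v" "\<And>v. v < n \<Longrightarrow> dep v < n"
    by (rule arborescenceE[OF G sA]) (rule that; assumption)
  have "parcs A \<subseteq> parcs G"
    using sA by (auto simp: spanning_arborescence_def spanning_def subgraph_def)
  then have AG: "u < n" "v < n" "u \<noteq> v" if "(u, v) \<in> parcs A" for u v
    using that metric_atspD(2)[OF G] by auto
  have finA: "finite (parcs A)"
    using \<open>parcs A \<subseteq> parcs G\<close> fin_digraph.finite_arcs[OF metric_atspD(4)[OF G]]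
    by (auto intro: finite_subset)
  have kept: "kept_arc c A u v \<longleftrightarrow> parent_code c A v = Suc u" for u v
  proof
    assume u: "kept_arc c A u v"
    have "(THE u. kept_arc c A u v) = u"
      using u uniq by (intro the_equality) (auto simp: kept_arc_def)
    with u show "parent_code c A v = Suc u"
      by (auto simp: parent_code_def)
  next
    assume p: "parent_code c A v = Suc u"
    then obtain w where w: "kept_arc c A w v"
      by (auto simp: parent_code_def split: if_splits)
    have "(THE u. kept_arc c A u v) = w"
      using w uniq by (intro the_equality) (auto simp: kept_arc_def)
    with p w show "kept_arc c A u v"
      by (auto simp: parent_code_def split: if_splits)
  qed
  have "rooted_forest n (arc_cost n c) (parent_code c A) dep"
  proof
    show "arc_cost n c u w \<le> arc_cost n c u v + arc_cost n c v w" if "u < n" "v < n" "w < n" for u v w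
      using metric_atspD(7)[OF G that] .
    show "u < n \<and> dep u < dep v \<and> arc_cost n c v u \<le> arc_cost n c u v"
      if "v < n" "parent_code c A v = Suc u" for u v
    proof -
      have uv: "(u, v) \<in> parcs A" "c (v, u) \<le> c (u, v)"
        using that(2) unfolding kept[symmetric] by (auto simp: kept_arc_def)
      then show ?thesis
        using AG[OF uv(1)] dep(1)[OF uv(1)] by (auto simp: arc_cost_def)
    qed
  qed (use r dep in auto)
  moreover have "card {v. v < n \<and> parent_code c A v = 0} = Suc (card (one_way_arcs c A))"
  proof -
    have "{v. v < n \<and> parent_code c A v = 0} = insert r (snd ` one_way_arcs c A)"
    proof (intro equalityI subsetI)
      fix v assume v: "v \<in> {v. v < n \<and> parent_code c A v = 0}"
      then have nk: "\<not> kept_arc c A u v" for u using kept by simp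
      show "v \<in> insert r (snd ` one_way_arcs c A)"
      proof (cases "v = r")
        case False
        with v ex obtain u where "(u, v) \<in> parcs A" by blast
        with nk[of u] show ?thesis
          by (force simp: kept_arc_def one_way_arcs_def)
      qed simp
    next
      fix v assume v: "v \<in> insert r (snd ` one_way_arcs c A)"
      have "\<not> kept_arc c A u v" for u
      proof
        assume "kept_arc c A u v"
        then have u: "(u, v) \<in> parcs A" "\<not> c (u, v) < c (v, u)" by (auto simp: kept_arc_def)
        with v r obtain w where "(w, v) \<in> parcs A" "c (w, v) < c (v, w)"
          by (auto simp: one_way_arcs_def)
        with u uniq show False by metis
      qed
      then have "parent_code c A v = 0" by (simp add: parent_code_def)
      moreover have "v < n" using v r AG by (auto simp: one_way_arcs_def)
      ultimately show "v \<in> {v. v < n \<and> parent_code c A v = 0}" by simp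
    qed
    moreover have "r \<notin> snd ` one_way_arcs c A" using r by (auto simp: one_way_arcs_def)
    moreover have "inj_on snd (one_way_arcs c A)"
      using uniq by (auto simp: inj_on_def one_way_arcs_def)
    moreover have "finite (one_way_arcs c A)"
      using finA by (rule rev_finite_subset) (auto simp: one_way_arcs_def)
    ultimately show ?thesis by (simp add: card_image)
  qed
  moreover note kept
  moreover have "(\<Sum>v | v < n \<and> parent_code c A v \<noteq> 0. arc_cost n c (parent_code c A v - 1) v) \<le> sum c (parcs A)"
  proof -
    let ?V = "{v. v < n \<and> parent_code c A v \<noteq> 0}" and ?f = "\<lambda>v. (parent_code c A v - 1, v)"
    have img: "?f v \<in> parcs A" if "v \<in> ?V" for v
      using that kept[of "parent_code c A v - 1" v] by (auto simp: kept_arc_def)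
    have "(\<Sum>v\<in>?V. arc_cost n c (parent_code c A v - 1) v) = (\<Sum>v\<in>?V. c (?f v))"
      using img AG by (intro sum.cong) (auto simp: arc_cost_def)
    also have "\<dots> = sum c (?f ` ?V)"
      by (subst sum.reindex) (auto simp: inj_on_def)
    also have "\<dots> \<le> sum c (parcs A)"
      using img finA \<open>parcs A \<subseteq> parcs G\<close> G by (intro sum_mono2) (auto simp: metric_atsp_def)
    finally show ?thesis .
  qed
  ultimately show ?thesis using that by blast
qed

section \<open>Reasoning about programs\<close>

text \<open>The number \<open>t\<close> of steps executed so far is threaded through the predicate transformer, so that the rule
  for sequential composition is plain composition.\<close>

definition wp :: "com \<Rightarrow> (nat \<Rightarrow> state \<Rightarrow> bool) \<Rightarrow> nat \<Rightarrow> state \<Rightarrow> bool" where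
  "wp P Q t s \<longleftrightarrow> (\<exists>t' s'. exec P s t' s' \<and> Q (t + t') s')"

lemma wp_Instr [simp]: "wp (Instr i) Q t s \<longleftrightarrow> Q (Suc t) (exec_instr i s)"
proof
  assume "wp (Instr i) Q t s"
  then obtain t' s' where "exec (Instr i) s t' s'" and Q: "Q (t + t') s'"
    by (auto simp: wp_def)
  then show "Q (Suc t) (exec_instr i s)"
    by (cases rule: exec.cases) auto
next
  assume "Q (Suc t) (exec_instr i s)"
  then show "wp (Instr i) Q t s"
    unfolding wp_def using exec.Instr[of i s] by force
qed

lemma wp_Seq [simp]: "wp (Seq P R) Q t s \<longleftrightarrow> wp P (wp R Q) t s"
proof
  assume "wp (Seq P R) Q t s"
  then obtain t' s' where "exec (Seq P R) s t' s'" and Q: "Q (t + t') s'"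
    by (auto simp: wp_def)
  then show "wp P (wp R Q) t s"
    by (cases rule: exec.cases) (auto simp: wp_def add.assoc)
next
  assume "wp P (wp R Q) t s"
  then show "wp (Seq P R) Q t s"
    by (auto simp: wp_def add.assoc intro: exec.Seq)
qed

lemma wp_If [simp]:
  "wp (If b P R) Q t s \<longleftrightarrow> (if eval_test b s then wp P Q (Suc t) s else wp R Q (Suc t) s)"
proof
  assume "wp (If b P R) Q t s"
  then obtain t' s' where "exec (If b P R) s t' s'" and Q: "Q (t + t') s'"
    by (auto simp: wp_def)
  then show "if eval_test b s then wp P Q (Suc t) s else wp R Q (Suc t) s"
    by (cases rule: exec.cases) (auto simp: wp_def)
next
  assume "if eval_test b s then wp P Q (Suc t) s else wp R Q (Suc t) s"
  then show "wp (If b P R) Q t s"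
    unfolding wp_def using exec.IfTrue[of b s P _ _ R] exec.IfFalse[of b s R _ _ P]
    by (force split: if_splits)
qed

lemma wp_mono: "wp P Q t s \<Longrightarrow> (\<And>t' s'. Q t' s' \<Longrightarrow> Q' t' s') \<Longrightarrow> wp P Q' t s"
  by (auto simp: wp_def)

lemma wp_While_end: "\<not> eval_test b s \<Longrightarrow> Q (Suc t) s \<Longrightarrow> wp (While b P) Q t s"
  unfolding wp_def using exec.WhileFalse by fastforce

lemma wp_While_step:
  assumes "eval_test b s" "wp P (wp (While b P) Q) (Suc t) s"
  shows "wp (While b P) Q t s"
proof -
  obtain t1 s1 t2 s2 where "exec P s t1 s1" "exec (While b P) s1 t2 s2" "Q (Suc t + t1 + t2) s2"
    using assms(2) by (auto simp: wp_def)
  with assms(1) show ?thesis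
    unfolding wp_def using exec.WhileTrue[of b s P t1 s1 t2 s2]
    by (intro exI[of _ "1 + t1 + t2"] exI[of _ s2]) (auto simp: add.assoc)
qed

lemma wp_for:
  assumes step: "\<And>i s t. i < m \<Longrightarrow> I i s \<Longrightarrow>
      eval_test b s \<and> wp P (\<lambda>t' s'. t' \<le> t + K \<and> I (Suc i) s') t s"
    and stop: "\<And>s. I m s \<Longrightarrow> \<not> eval_test b s"
    and init: "I 0 s"
    and post: "\<And>t' s'. I m s' \<Longrightarrow> t' \<le> t + m * Suc K + 1 \<Longrightarrow> Q t' s'"
  shows "wp (While b P) Q t s"
proof -
  have "wp (While b P) Q t' s'" if "i \<le> m" "I i s'" "t' \<le> t + i * Suc K" for i t' s'
    using that
  proof (induction i arbitrary: t' s' rule: inc_induct)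
    case base
    then show ?case
      by (intro wp_While_end stop post) auto
  next
    case (step i)
    have *: "eval_test b s'" "wp P (\<lambda>t'' s''. t'' \<le> Suc t' + K \<and> I (Suc i) s'') (Suc t') s'"
      using assms(1)[OF step.hyps(2) step.prems(1)] by blast+
    show ?case
      by (rule wp_While_step[OF *(1)], rule wp_mono[OF *(2)]) (use step in auto)
  qed
  from this[of 0 s t] init show ?thesis by simp
qed


section \<open>The program\<close>

text \<open>
  Fixed registers: 0 holds \<open>n\<close>, 1 holds 1, 2 holds 0, 3 holds the number \<open>k + 1\<close> of roots, 4 holds \<open>k\<close>,
  5 holds \<open>2 ^ k * (k + 1)\<close>. Arrays for natural numbers: 1 output, 2 parent codes (reset to 0 as soon as
  the vertex is on the cycle), 3 roots, 4 roots times \<open>n\<close> (row addresses of the cost matrix),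
  5 the numbers \<open>2 ^ i * (k + 1)\<close>, 6 minimisers of the Held-Karp recursion, 7 successors on the cycle.
  Real array 1 holds the Held-Karp table. The entry for the subset with code \<open>S\<close> and the vertex \<open>j\<close> has
  address \<open>S * (k + 1) + j\<close>; codes occur only as multiples of \<open>k + 1\<close>, so no multiplication is needed.
\<close>

abbreviation skip :: com where
  "skip \<equiv> Instr (NCopy 2 2)"

fun block :: "com list \<Rightarrow> com" where
  "block [] = skip"
| "block [P] = P"
| "block (P # Q # Ps) = Seq P (block (Q # Ps))"

text \<open>Registers 8 and 9 hold the addresses of \<open>(u, v)\<close> and \<open>(v, u)\<close>,
  register 11 the code of \<open>u\<close>. Register 8 is not reset between rows, since the end of
  one row is the start of the next.\<close>

definition parents_cell :: com where
  "parents_cell = block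
    [Instr (NLoad 10 0 8),
     If (NEq 10 1)
       (block [Instr (RLoad 0 0 8), Instr (RLoad 1 0 9), If (RLess 0 1) skip (Instr (NStore 2 7 11))])
       skip,
     Instr (NAdd 8 8 1), Instr (NAdd 9 9 0), Instr (NAdd 7 7 1)]"

definition parents_row :: com where
  "parents_row = block
    [Instr (NConst 7 0), Instr (NCopy 9 6), Instr (NAdd 11 6 1),
     While (NLess 7 0) parents_cell,
     Instr (NCopy 6 11)]"

definition find_parents :: com where
  "find_parents = block [Instr (NConst 1 1), While (NLess 6 0) parents_row]"

definition collect_root :: com where
  "collect_root = block
    [Instr (NLoad 10 2 6),
     If (NEq 10 2) (block [Instr (NStore 3 3 6), Instr (NStore 4 3 8), Instr (NAdd 3 3 1)]) skip,
     Instr (NAdd 8 8 0), Instr (NAdd 6 6 1)]"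

definition collect_roots :: com where
  "collect_roots = block
    [Instr (NConst 6 0), Instr (NConst 8 0), While (NLess 6 0) collect_root, Instr (NSub 4 3 1)]"

definition power_step :: com where
  "power_step = block [Instr (NAdd 5 5 5), Instr (NAdd 6 6 1), Instr (NStore 5 6 5)]"

definition powers :: com where
  "powers = block
    [Instr (NStore 5 2 3), Instr (NCopy 5 3), Instr (NConst 6 0),
     While (NLess 6 4) power_step]"

text \<open>Register 12 holds the candidate, 6 the code of the whole subset, 13 the part of the code
  that is still unexamined, and 11 the best candidate so far. The candidate is outside the subset
  iff 13 is less than 14.\<close>

definition hk_candidate :: com where
  "hk_candidate =
    (let accept = block [Instr (RCopy 0 1), Instr (NCopy 11 12)] in
     block
      [Instr (NSub 12 12 1), Instr (NLoad 14 5 12),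
       If (NLess 13 14) skip (block
         [Instr (NSub 13 13 14), Instr (NLoad 10 3 12), Instr (NAdd 10 9 10), Instr (RLoad 1 0 10),
          Instr (NSub 10 6 14), Instr (NAdd 10 10 12), Instr (RLoad 2 1 10), Instr (RAdd 1 1 2),
          If (NEq 11 4) accept (If (RLess 1 0) accept skip)])])"

definition hk_entry :: com where
  "hk_entry = block
    [Instr (NLoad 9 4 7), Instr (NLoad 10 3 4), Instr (NAdd 10 9 10), Instr (RLoad 0 0 10),
     Instr (NCopy 11 4), Instr (NCopy 12 4), Instr (NCopy 13 6),
     While (NLess 2 12) hk_candidate,
     Instr (RStore 1 8 0), Instr (NStore 6 8 11), Instr (NAdd 8 8 1), Instr (NAdd 7 7 1)]"

text \<open>After the \<open>k + 1\<close> entries of a row, register 8 has advanced to the code of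
  the next subset.\<close>

definition hk_subset :: com where
  "hk_subset = block
    [Instr (NConst 7 0), Instr (NCopy 8 6), While (NLess 7 3) hk_entry, Instr (NCopy 6 8)]"

definition held_karp :: com where
  "held_karp = block [Instr (NConst 6 0), While (NLess 6 5) hk_subset]"

definition link_next :: com where
  "link_next = block
    [Instr (NAdd 10 6 7), Instr (NLoad 11 6 10), Instr (NLoad 13 3 11), Instr (NStore 7 9 13),
     Instr (NCopy 9 13), Instr (NLoad 14 5 11), Instr (NSub 6 6 14), Instr (NCopy 7 11),
     Instr (NAdd 12 12 1)]"

definition link_roots :: com where
  "link_roots = block
    [Instr (NCopy 7 4), Instr (NSub 6 5 3), Instr (NLoad 9 3 4), Instr (NConst 12 0),
     While (NLess 12 4) link_next,
     Instr (NLoad 10 3 4), Instr (NStore 7 9 10)]"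

text \<open>A vertex whose parent is still pending waits for a later sweep. Since code 0 stands both
  for "root" and for "inserted", the roots count as inserted from the start.\<close>

definition insert_vertex :: com where
  "insert_vertex = block
    [Instr (NLoad 10 2 7),
     If (NEq 10 2) skip (block
       [Instr (NSub 10 10 1), Instr (NLoad 11 2 10),
        If (NEq 11 2)
          (block [Instr (NLoad 11 7 10), Instr (NStore 7 7 11), Instr (NStore 7 10 7), Instr (NStore 2 7 2)])
          skip]),
     Instr (NAdd 7 7 1)]"

definition insert_round :: com where
  "insert_round = block [Instr (NConst 7 0), While (NLess 7 0) insert_vertex, Instr (NAdd 6 6 1)]"

definition insert_vertices :: com where
  "insert_vertices = block
    [Instr (NConst 6 0), While (NLess 6 0) insert_round]"

definition write_vertex :: com where
  "write_vertex = block [Instr (NStore 1 6 10), Instr (NLoad 10 7 10), Instr (NAdd 6 6 1)]"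

definition write_tour :: com where
  "write_tour = block
    [Instr (NLoad 10 3 4), Instr (NConst 6 0),
     While (NLess 6 0) write_vertex]"

definition atsp_program :: com where
  "atsp_program = block
    [find_parents, collect_roots, powers, held_karp, link_roots, insert_vertices, write_tour]"

section \<open>Verification of the program\<close>

context rooted_forest
begin

section \<open>Roots of the forest\<close>

definition roots :: "nat list" where
  "roots = filter (\<lambda>v. par v = 0) [0..<n]"

definition k :: nat where
  "k = length roots - 1"

lemma set_roots: "set roots = {v. v < n \<and> par v = 0}"
  by (auto simp: roots_def)

lemma distinct_roots: "distinct roots"
  by (simp add: roots_def)

text \<open>A vertex of least \<open>dep\<close> has no parent, so a root exists and the subtraction
  in \<open>k\<close> is not truncated.\<close>

lemma length_roots: "length roots = Suc k"
proof -
  define v where "v = arg_min dep (\<lambda>v. v < n)"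
  have v: "v < n" "\<And>u. u < n \<Longrightarrow> dep v \<le> dep u"
    unfolding v_def using arg_min_nat_lemma[of "\<lambda>v. v < n" 0 dep] n_pos by auto
  have "par v = 0"
  proof (rule ccontr)
    assume "par v \<noteq> 0"
    then obtain u where "par v = Suc u" using not0_implies_Suc by blast
    with par[OF v(1)] v(2)[of u] show False by auto
  qed
  with v set_roots have "roots \<noteq> []" by force
  then show ?thesis by (simp add: k_def)
qed

lemma root_less: "i \<le> k \<Longrightarrow> roots ! i < n"
  using set_roots nth_mem[of i roots] length_roots by auto

section \<open>Preparation: parents, roots and powers of two\<close>

definition base :: "state \<Rightarrow> bool" where
  "base s \<longleftrightarrow> nreg s 0 = n \<and> nreg s 1 = 1 \<and> nreg s 2 = 0 \<and>
     (\<forall>u<n. \<forall>v<n. rarr s 0 (u * n + v) = d u v) \<and>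
     (\<forall>u<n. \<forall>v<n. narr s 0 (u * n + v) = 1 \<and> \<not> d u v < d v u \<longleftrightarrow> par v = Suc u)"

definition pars :: "nat \<Rightarrow> nat" where
  "pars v = (if v < n then par v else 0)"

lemma wp_parents_row:
  assumes "base s" "nreg s 6 = u" "u < n" "nreg s 8 = u * n"
    and "narr s 2 = (\<lambda>v. if v < n \<and> par v \<le> u then par v else 0)"
  shows "wp parents_row (\<lambda>t' s'. t' \<le> t + (10 * n + 10) \<and> base s' \<and> nreg s' 3 = nreg s 3 \<and>
    nreg s' 6 = Suc u \<and> nreg s' 8 = Suc u * n \<and>
    narr s' 2 = (\<lambda>v. if v < n \<and> par v \<le> Suc u then par v else 0)) t s"
proof -
  \<comment> \<open>Contents of the parent array when row \<open>u\<close> has been scanned up to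
    column \<open>v\<close>. Codes are shifted by one: \<open>par w \<le> u\<close> means that the
    parent is below \<open>u\<close> or missing, and only columns before \<open>v\<close> may
    already show \<open>Suc u\<close>.\<close>
  define F where "F v = (\<lambda>w. if w < n \<and> par w \<le> (if w < v then Suc u else u) then par w else 0)" for v
  have F_step: "(F v)(v := Suc u) = F (Suc v)" if "v < n" "par v = Suc u" for v
    using that by (auto simp: F_def fun_eq_iff)
  have F_skip: "F v = F (Suc v)" if "par v \<noteq> Suc u" for v
    using that by (auto simp: F_def fun_eq_iff less_Suc_eq le_Suc_eq)
  let ?I = "\<lambda>v s'. base s' \<and> nreg s' 3 = nreg s 3 \<and> nreg s' 11 = Suc u \<and> nreg s' 7 = v \<and>
    nreg s' 8 = u * n + v \<and> nreg s' 9 = v * n + u \<and> narr s' 2 = F v"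
  have step: "eval_test (NLess 7 0) s' \<and> wp parents_cell (\<lambda>t' s'. t' \<le> t + 9 \<and> ?I (Suc v) s') t s'"
    if v: "v < n" and I: "?I v s'" for v s' t
  proof -
    have "narr s' 0 (u * n + v) = 1 \<and> \<not> d u v < d v u \<longleftrightarrow> par v = Suc u"
      using I v \<open>u < n\<close> by (simp add: base_def)
    then show ?thesis
      using I v \<open>u < n\<close> F_step[of v] F_skip[of v] by (auto simp: base_def parents_cell_def)
  qed
  have "F 0 = narr s 2" using assms(5) by (simp add: F_def)
  then show ?thesis
    using assms unfolding parents_row_def
    apply simp
    apply (rule wp_for[where m = n and K = 9 and I = ?I, OF step])
    by (auto simp: base_def F_def fun_eq_iff)
qed

lemma wp_find_parents:
  assumes "nreg s 0 = n" "nreg s 2 = 0" "nreg s 3 = 0" "nreg s 6 = 0" "nreg s 8 = 0" "narr s 2 = (\<lambda>_. 0)"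
    and "\<And>u v. u < n \<Longrightarrow> v < n \<Longrightarrow> rarr s 0 (u * n + v) = d u v"
    and "\<And>u v. u < n \<Longrightarrow> v < n \<Longrightarrow>
      narr s 0 (u * n + v) = 1 \<and> \<not> d u v < d v u \<longleftrightarrow> par v = Suc u"
  shows "wp find_parents (\<lambda>t' s'. t' \<le> t + (n * Suc (10 * n + 10) + 2) \<and> base s' \<and> nreg s' 3 = 0 \<and>
    narr s' 2 = pars) t s"
proof -
  let ?I = "\<lambda>u s'. base s' \<and> nreg s' 3 = 0 \<and> nreg s' 6 = u \<and> nreg s' 8 = u * n \<and>
    narr s' 2 = (\<lambda>v. if v < n \<and> par v \<le> u then par v else 0)"
  have step: "eval_test (NLess 6 0) s' \<and>
      wp parents_row (\<lambda>t' s'. t' \<le> t + (10 * n + 10) \<and> ?I (Suc u) s') t s'"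
    if "u < n" "?I u s'" for u s' t
    using wp_mono[OF wp_parents_row[of s' u t]] that by (auto simp: base_def)
  \<comment> \<open>Parents are below \<open>n\<close>, so their codes are at most \<open>n\<close>
    and the restriction to finished rows becomes void after \<open>n\<close> rows.\<close>
  have "par v \<le> n" if "v < n" for v
    using par[OF that] by (cases "par v") auto
  then have fin: "(\<lambda>v. if v < n \<and> par v \<le> n then par v else 0) = pars"
    by (auto simp: pars_def fun_eq_iff)
  show ?thesis
    unfolding find_parents_def using assms
    apply simp
    apply (rule wp_for[where m = n and K = "10 * n + 10" and I = ?I, OF step])
    by (auto simp: base_def fin)
qed

definition nroots :: nat where
  "nroots = Suc k"

lemma nroots_pos [simp]: "0 < nroots"
  by (simp add: nroots_def)

definition rooted :: "state \<Rightarrow> bool" where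
  "rooted s \<longleftrightarrow> base s \<and> nreg s 3 = nroots \<and> nreg s 4 = k \<and>
     (\<forall>i\<le>k. narr s 3 i = roots ! i \<and> narr s 4 i = roots ! i * n)"

lemma wp_collect_roots:
  assumes "base s" "nreg s 3 = 0" "narr s 2 = pars"
  shows "wp collect_roots (\<lambda>t' s'. t' \<le> t + (9 * n + 5) \<and> rooted s' \<and> narr s' 2 = pars) t s"
proof -
  define rs where "rs v = filter (\<lambda>v. par v = 0) [0..<v]" for v
  have rs_Suc: "rs (Suc v) = (if par v = 0 then rs v @ [v] else rs v)" for v
    by (simp add: rs_def)
  let ?I = "\<lambda>v s'. base s' \<and> nreg s' 6 = v \<and> nreg s' 8 = v * n \<and> nreg s' 3 = length (rs v) \<and>
    (\<forall>i<length (rs v). narr s' 3 i = rs v ! i \<and> narr s' 4 i = rs v ! i * n) \<and> narr s' 2 = pars"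
  have step: "eval_test (NLess 6 0) s' \<and> wp collect_root (\<lambda>t' s'. t' \<le> t + 8 \<and> ?I (Suc v) s') t s'"
    if "v < n" "?I v s'" for v s' t
    using that by (simp add: base_def collect_root_def rs_Suc pars_def nth_append less_Suc_eq)
  have "rs n = roots" "rs 0 = []" by (simp_all add: rs_def roots_def)
  then show ?thesis
    using assms unfolding collect_roots_def
    apply simp
    apply (rule wp_for[where m = n and K = 8 and I = ?I, OF step])
    by (auto simp: base_def rooted_def length_roots nroots_def)
qed

definition ready :: "state \<Rightarrow> bool" where
  "ready s \<longleftrightarrow> rooted s \<and> nreg s 5 = 2 ^ k * nroots \<and> (\<forall>i\<le>k. narr s 5 i = 2 ^ i * nroots)"

lemma wp_powers:
  assumes "rooted s" "narr s 2 = pars"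
  shows "wp powers (\<lambda>t' s'. t' \<le> t + (4 * k + 4) \<and> ready s' \<and> narr s' 2 = pars) t s"
proof -
  let ?I = "\<lambda>i s'. rooted s' \<and> nreg s' 6 = i \<and> nreg s' 5 = 2 ^ i * nroots \<and>
    (\<forall>j\<le>i. narr s' 5 j = 2 ^ j * nroots) \<and> narr s' 2 = pars"
  have step: "eval_test (NLess 6 4) s' \<and>
      wp power_step (\<lambda>t' s'. t' \<le> t + 3 \<and> ?I (Suc i) s') t s'"
    if "i < k" "?I i s'" for i s' t
    using that by (auto simp: base_def rooted_def power_step_def le_Suc_eq)
  show ?thesis
    using assms unfolding powers_def
    apply simp
    apply (rule wp_for[where m = k and K = 3 and I = ?I, OF step])
    by (auto simp: base_def rooted_def ready_def)
qed

section \<open>Filling the Held-Karp table\<close>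

definition root_dist :: "nat \<Rightarrow> nat \<Rightarrow> real" where
  "root_dist i j = d (roots ! i) (roots ! j)"

definition tab :: "(nat \<Rightarrow> 'b) \<Rightarrow> nat \<Rightarrow> nat \<Rightarrow> 'b" where
  "tab a S j = a (S * nroots + j)"

lemma tab_upd_same: "tab (a(S * nroots + j := x)) S j = x"
  by (simp add: tab_def)

text \<open>Columns stay below \<open>nroots\<close>, so division by \<open>nroots\<close> recovers
  the row from an address and different cells do not collide.\<close>

lemma tab_upd_other:
  assumes "j \<le> k" "i \<le> k" "T \<noteq> S \<or> i \<noteq> j"
  shows "tab (a(S * nroots + j := x)) T i = tab a T i"
proof -
  have "T * nroots + i \<noteq> S * nroots + j"
  proof
    assume eq: "T * nroots + i = S * nroots + j"
    have "i < nroots" "j < nroots" using assms by (simp_all add: nroots_def)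
    then have "(T * nroots + i) div nroots = T" "(S * nroots + j) div nroots = S"
      by simp_all
    with eq have "T = S" by metis
    with eq assms(3) show False by simp
  qed
  then show ?thesis by (simp add: tab_def)
qed

text \<open>The bound consists of 11 single instructions, at most 15 steps and one test for each of
  the \<open>k\<close> candidates, and the failing test.\<close>

lemma wp_hk_entry:
  assumes "ready s" "S < 2 ^ k" "j \<le> k" "nreg s 6 = S * nroots" "nreg s 7 = j" "nreg s 8 = S * nroots + j"
  shows "wp hk_entry (\<lambda>t' s'. t' \<le> t + (16 * k + 12) \<and> ready s' \<and> nreg s' 6 = S * nroots \<and>
    nreg s' 7 = Suc j \<and> nreg s' 8 = Suc (S * nroots + j) \<and> narr s' 2 = narr s 2 \<and>
    (\<exists>x b. rarr s' 1 = (rarr s 1)(S * nroots + j := x) \<and> narr s' 6 = (narr s 6)(S * nroots + j := b) \<and>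
      hk_best root_dist k (tab (rarr s 1)) S j 0 x b)) t s"
proof -
  let ?best = "hk_best root_dist k (tab (rarr s 1)) S j"
  let ?J = "\<lambda>l s'. ready s' \<and> nreg s' 6 = S * nroots \<and> nreg s' 7 = j \<and> nreg s' 8 = S * nroots + j \<and>
    nreg s' 9 = roots ! j * n \<and> narr s' 2 = narr s 2 \<and> rarr s' 1 = rarr s 1 \<and> narr s' 6 = narr s 6 \<and>
    nreg s' 12 = l \<and> nreg s' 13 = S mod 2 ^ l * nroots \<and> ?best l (rreg s' 0) (nreg s' 11)"
  \<comment> \<open>\<open>wp_for\<close> counts upwards, whereas the candidates are tried from
    \<open>k - 1\<close> down to 0.\<close>
  let ?I = "\<lambda>i. ?J (k - i)"
  have step: "eval_test (NLess 2 12) s' \<and>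
      wp hk_candidate (\<lambda>t' s'. t' \<le> t + 15 \<and> ?I (Suc i) s') t s'"
    if i: "i < k" and I: "?I i s'" for i s' t
  proof -
    define l where "l = k - Suc i"
    have l: "k - i = Suc l" "l < k" "k - Suc i = l" using i by (auto simp: l_def)
    note I = I[unfolded l]
    have z: "narr s' 5 l = 2 ^ l * nroots" and rl: "narr s' 3 l = roots ! l"
      using I l by (auto simp: ready_def rooted_def)
    have cost: "rarr s' 0 (roots ! j * n + roots ! l) = root_dist j l"
      using I l assms(3) root_less by (simp add: ready_def rooted_def base_def root_dist_def)
    have less: "S mod 2 ^ l < 2 ^ l" by simp
    \<comment> \<open>Power and remainder are both stored times \<open>nroots\<close>; scaling
      preserves the comparison, so \<open>X < Z\<close> decides the membership of
      \<open>l\<close>.\<close>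
    define Z where "Z = 2 ^ l * nroots"
    define X where "X = S mod 2 ^ Suc l * nroots"
    from less have "S mod 2 ^ l * nroots < Z" by (simp add: Z_def)
    moreover have "X = (if l \<in> set_decode S then Z else 0) + S mod 2 ^ l * nroots"
      unfolding X_def Z_def mod_power2_Suc by (simp add: add_mult_distrib)
    ultimately have x: "X < Z \<longleftrightarrow> l \<notin> set_decode S"
      "l \<notin> set_decode S \<Longrightarrow> X = S mod 2 ^ l * nroots"
      "l \<in> set_decode S \<Longrightarrow> X - Z = S mod 2 ^ l * nroots"
      by simp_all
    have addr: "S * nroots - Z + l = (S - 2 ^ l) * nroots + l"
      by (simp only: Z_def diff_mult_distrib)
    have D: "rarr s' 1 ((S - 2 ^ l) * nroots + l) = tab (rarr s 1) (S - 2 ^ l) l"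
      using I by (simp add: tab_def)
    have I': "ready s'" "nreg s' 6 = S * nroots" "nreg s' 7 = j" "nreg s' 8 = S * nroots + j"
      "nreg s' 9 = roots ! j * n" "narr s' 2 = narr s 2" "rarr s' 1 = rarr s 1" "narr s' 6 = narr s 6"
      "nreg s' 12 = Suc l" "nreg s' 13 = X" "?best (Suc l) (rreg s' 0) (nreg s' 11)"
      using I by (simp_all add: X_def)
    have regs: "nreg s' 0 = n" "nreg s' 1 = 1" "nreg s' 2 = 0" "nreg s' 4 = k" "narr s' 5 l = Z"
      "narr s' 3 l = roots ! l"
      using I'(1) z rl by (simp_all add: ready_def rooted_def base_def Z_def)
    note best = hk_best_step[OF I'(11) assms(2)]
    show ?thesis
      unfolding l(3)
    proof (cases "l \<in> set_decode S")
      case True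
      then show "eval_test (NLess 2 12) s' \<and> wp hk_candidate (\<lambda>t' s'. t' \<le> t + 15 \<and> ?J l s') t s'"
        using I'(1-10) regs rl cost x addr D best(2,3)[OF True]
        by (cases "nreg s' 11 = k"; cases "root_dist j l + tab (rarr s 1) (S - 2 ^ l) l < rreg s' 0";
            simp add: hk_candidate_def Let_def ready_def rooted_def base_def)
    next
      case False
      then show "eval_test (NLess 2 12) s' \<and> wp hk_candidate (\<lambda>t' s'. t' \<le> t + 15 \<and> ?J l s') t s'"
        using I'(1-10) regs x best(1)[OF False]
        by (simp add: hk_candidate_def Let_def) (simp add: ready_def rooted_def base_def)
    qed
  qed
  have cost: "rarr s 0 (roots ! j * n + roots ! k) = root_dist j k"
    using assms root_less by (simp add: ready_def rooted_def base_def root_dist_def)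
  have mod: "S mod 2 ^ k = S" using assms(2) by simp
  have init: "?best k (root_dist j k) k"
    using set_decode_less[OF _ assms(2)] by (simp add: hk_best_def)
  show ?thesis
    using assms cost init mod unfolding hk_entry_def
    apply (simp add: ready_def rooted_def base_def)
    apply (rule wp_for[where m = k and K = 15 and I = ?I, OF step])
    by (auto simp: ready_def rooted_def base_def)
qed

lemma wp_hk_subset:
  assumes "ready s" "S < 2 ^ k" "nreg s 6 = S * nroots"
    and "\<And>T. T < S \<Longrightarrow> hk_row root_dist k (tab (rarr s 1)) (tab (narr s 6)) T"
  shows "wp hk_subset (\<lambda>t' s'. t' \<le> t + (Suc k * Suc (16 * k + 12) + 4) \<and> ready s' \<and>
    narr s' 2 = narr s 2 \<and> nreg s' 6 = Suc S * nroots \<and>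
    (\<forall>T<Suc S. hk_row root_dist k (tab (rarr s' 1)) (tab (narr s' 6)) T)) t s"
proof -
  let ?best = "\<lambda>s' T i. hk_best root_dist k (tab (rarr s' 1)) T i 0 (tab (rarr s' 1) T i) (tab (narr s' 6) T i)"
  let ?I = "\<lambda>j s'. ready s' \<and> nreg s' 6 = S * nroots \<and> nreg s' 7 = j \<and> nreg s' 8 = S * nroots + j \<and>
    narr s' 2 = narr s 2 \<and> (\<forall>T i. i \<le> k \<longrightarrow> T < S \<or> T = S \<and> i < j \<longrightarrow> ?best s' T i)"
  have step: "eval_test (NLess 7 3) s' \<and>
      wp hk_entry (\<lambda>t' s'. t' \<le> t + (16 * k + 12) \<and> ?I (Suc j) s') t s'"
    if j: "j < Suc k" and I: "?I j s'" for j s' t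
  proof (intro conjI)
    show "eval_test (NLess 7 3) s'" using j I by (auto simp: ready_def rooted_def nroots_def)
    have I': "ready s'" "nreg s' 6 = S * nroots" "nreg s' 7 = j" "nreg s' 8 = S * nroots + j" and "j \<le> k"
      using I j by auto
    show "wp hk_entry (\<lambda>t' s'. t' \<le> t + (16 * k + 12) \<and> ?I (Suc j) s') t s'"
    proof (rule wp_mono[OF wp_hk_entry[OF I'(1) assms(2) \<open>j \<le> k\<close> I'(2-4)]], clarify, intro conjI)
      fix t' s'' x b
      assume s'': "ready s''" "nreg s'' 6 = S * nroots" "nreg s'' 7 = Suc j"
        "nreg s'' 8 = Suc (S * nroots + j)" "narr s'' 2 = narr s' 2"
        and R: "rarr s'' 1 = (rarr s' 1)(S * nroots + j := x)"
        and N: "narr s'' 6 = (narr s' 6)(S * nroots + j := b)"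
        and x: "hk_best root_dist k (tab (rarr s' 1)) S j 0 x b"
      note other = tab_upd_other[OF \<open>j \<le> k\<close>, where S = S]
      show "narr s'' 2 = narr s 2" "nreg s'' 8 = S * nroots + Suc j" using s'' I by auto
      show "\<forall>T i. i \<le> k \<longrightarrow> T < S \<or> T = S \<and> i < Suc j \<longrightarrow> ?best s'' T i"
      proof (intro allI impI)
        fix T i assume i: "i \<le> k" and T: "T < S \<or> T = S \<and> i < Suc j"
        have "T < 2 ^ k" using T assms(2) by auto
        \<comment> \<open>The write goes to row \<open>S\<close>, while an entry of a row
          \<open>T \<le> S\<close> refers only to rows below \<open>T\<close>, so its recurrence may
          be read in the old table.\<close>
        have cong: "hk_best root_dist k (tab (rarr s'' 1)) T i 0 y a \<longleftrightarrow>
            hk_best root_dist k (tab (rarr s' 1)) T i 0 y a" for y a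
          using T unfolding R by (intro hk_best_cong[OF \<open>T < 2 ^ k\<close>] other) auto
        show "?best s'' T i"
        proof (cases "T = S \<and> i = j")
          case True
          then have "T = S" "i = j" by auto
          with x show ?thesis unfolding cong by (simp only: R N tab_upd_same)
        next
          case False
          then have "tab (rarr s'' 1) T i = tab (rarr s' 1) T i" "tab (narr s'' 6) T i = tab (narr s' 6) T i"
            unfolding R N using i by (intro other; auto)+
          moreover have "T < S \<or> T = S \<and> i < j" using T False by auto
          ultimately show ?thesis using I i unfolding cong by auto
        qed
      qed
    qed
  qed
  have fin: "\<forall>T<Suc S. hk_row root_dist k (tab (rarr s' 1)) (tab (narr s' 6)) T"
    if "?I (Suc k) s'" for s'
    using that unfolding hk_row_def by (metis less_Suc_eq less_Suc_eq_le)
  show ?thesis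
    using assms unfolding hk_subset_def
    apply (simp add: ready_def rooted_def base_def)
    apply (rule wp_for[where m = "Suc k" and K = "16 * k + 12" and I = ?I, OF step])
       apply assumption
      apply assumption
     apply (auto simp: ready_def rooted_def base_def nroots_def)[1]
    apply (auto simp: ready_def rooted_def base_def nroots_def hk_row_def)[1]
    subgoal for t' s' using fin[of s'] by (auto simp: ready_def rooted_def base_def nroots_def)
    done
qed

lemma wp_held_karp:
  assumes "ready s"
  shows "wp held_karp (\<lambda>t' s'. t' \<le> t + (2 ^ k * Suc (Suc k * Suc (16 * k + 12) + 4) + 2) \<and> ready s' \<and>
    narr s' 2 = narr s 2 \<and>
    (\<forall>S<2 ^ k. hk_row root_dist k (tab (rarr s' 1)) (tab (narr s' 6)) S)) t s"
proof -
  let ?I = "\<lambda>S s'. ready s' \<and> narr s' 2 = narr s 2 \<and> nreg s' 6 = S * nroots \<and>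
    (\<forall>T<S. hk_row root_dist k (tab (rarr s' 1)) (tab (narr s' 6)) T)"
  have step: "eval_test (NLess 6 5) s' \<and>
      wp hk_subset (\<lambda>t' s'. t' \<le> t + (Suc k * Suc (16 * k + 12) + 4) \<and> ?I (Suc S) s') t s'"
    if "S < 2 ^ k" "?I S s'" for S s' t
  proof
    show "eval_test (NLess 6 5) s'"
      using that by (simp add: ready_def)
    show "wp hk_subset (\<lambda>t' s'. t' \<le> t + (Suc k * Suc (16 * k + 12) + 4) \<and> ?I (Suc S) s') t s'"
      using that by (intro wp_mono[OF wp_hk_subset[of s' S]]) simp_all
  qed
  show ?thesis
    using assms unfolding held_karp_def
    apply (simp add: ready_def rooted_def base_def)
    apply (rule wp_for[where m = "2 ^ k" and K = "Suc k * Suc (16 * k + 12) + 4" and I = ?I, OF step])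
    by (auto simp: ready_def rooted_def base_def)
qed

section \<open>Following the minimisers to an optimal cycle through the roots\<close>

lemma roots_nth_eq_iff: "i \<le> k \<Longrightarrow> j \<le> k \<Longrightarrow> roots ! i = roots ! j \<longleftrightarrow> i = j"
  using distinct_roots length_roots by (simp add: nth_eq_iff_index_eq)

abbreviation first_root :: nat where
  "first_root \<equiv> roots ! k"

text \<open>\<open>zs @ [j]\<close> are the indices visited so far, beginning with the depot, and
  \<open>S\<close> codes those still to come. The cost equation is the telescoped recursion: the
  links already made and the remaining table value always add up to the total. The link of
  \<open>roots ! j\<close> is still to be set.\<close>

definition hk_trace :: "(nat \<Rightarrow> nat) \<Rightarrow> (nat \<Rightarrow> nat \<Rightarrow> real) \<Rightarrow> nat \<Rightarrow> nat \<Rightarrow> nat list \<Rightarrow> bool" where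
  "hk_trace nx D S j zs \<longleftrightarrow> S < 2 ^ k \<and> j \<le> k \<and> distinct (zs @ [j]) \<and> hd (zs @ [j]) = k \<and>
     set (zs @ [j]) = insert k ({..<k} - set_decode S) \<and>
     map nx (map ((!) roots) zs) = map ((!) roots) (tl (zs @ [j])) \<and>
     (\<Sum>v\<leftarrow>map ((!) roots) zs. d v (nx v)) + D S j = D (2 ^ k - 1) k"

text \<open>Ensures that \<open>S\<close> becomes empty after exactly \<open>k\<close> links and not
  before.\<close>

lemma hk_trace_length:
  assumes "hk_trace nx D S j zs"
  shows "length zs + card (set_decode S) = k"
proof -
  have sub: "set_decode S \<subseteq> {..<k}"
    using set_decode_less assms by (auto simp: hk_trace_def)
  have "length (zs @ [j]) = card (insert k ({..<k} - set_decode S))"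
    using assms unfolding hk_trace_def by (metis distinct_card)
  then have "length zs = card ({..<k} - set_decode S)"
    by simp
  also have "\<dots> = k - card (set_decode S)"
    using sub by (simp add: card_Diff_subset)
  finally show ?thesis
    using card_mono[OF _ sub] by simp
qed

text \<open>The visited roots are distinct, so a new link never overwrites an earlier one.\<close>

lemma hk_trace_upd:
  assumes "hk_trace nx D S j zs"
  shows "map (nx(roots ! j := x)) (map ((!) roots) zs) = map nx (map ((!) roots) zs)"
    and "(\<Sum>v\<leftarrow>map ((!) roots) zs. d v ((nx(roots ! j := x)) v)) = (\<Sum>v\<leftarrow>map ((!) roots) zs. d v (nx v))"
proof -
  have "roots ! j \<notin> set (map ((!) roots) zs)"
  proof
    assume "roots ! j \<in> set (map ((!) roots) zs)"
    then obtain z where z: "z \<in> set zs" "roots ! j = roots ! z" by auto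
    moreover from z(1) assms have "z \<in> insert k ({..<k} - set_decode S)"
      unfolding hk_trace_def by auto
    ultimately have "j = z"
      using assms roots_nth_eq_iff[of j z] by (auto simp: hk_trace_def)
    with z(1) assms show False by (simp add: hk_trace_def)
  qed
  then have eq: "(nx(roots ! j := x)) v = nx v" if "v \<in> set (map ((!) roots) zs)" for v
    using that by (metis fun_upd_other)
  show "map (nx(roots ! j := x)) (map ((!) roots) zs) = map nx (map ((!) roots) zs)"
    using eq by (rule map_cong[OF refl])
  show "(\<Sum>v\<leftarrow>map ((!) roots) zs. d v ((nx(roots ! j := x)) v)) = (\<Sum>v\<leftarrow>map ((!) roots) zs. d v (nx v))"
    using eq by (intro arg_cong[of _ _ sum_list] map_cong[OF refl]) simp
qed

lemma hk_trace_step: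
  assumes tr: "hk_trace nx D S j zs" and row: "hk_row root_dist k D B S" and "length zs < k"
  shows "B S j < k" "2 ^ B S j \<le> S"
    "hk_trace (nx(roots ! j := roots ! B S j)) D (S - 2 ^ B S j) (B S j) (zs @ [j])"
proof -
  have S: "S < 2 ^ k" "j \<le> k" using tr by (auto simp: hk_trace_def)
  have "S \<noteq> 0"
  proof
    assume "S = 0"
    with hk_trace_length[OF tr] \<open>length zs < k\<close> show False by simp
  qed
  note b = hk_argmin[OF row S(2) this]
  show bk: "B S j < k" and bS: "2 ^ B S j \<le> S"
    using set_decode_less[OF b(1) S(1)] set_decode_remove(1)[OF b(1)] by auto
  have set: "set (zs @ [j]) = insert k ({..<k} - set_decode S)"
    and hd: "hd (zs @ [j]) = k" and dist: "distinct (zs @ [j])"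
    and nx: "map nx (map ((!) roots) zs) = map ((!) roots) (tl (zs @ [j]))"
    and cost: "(\<Sum>v\<leftarrow>map ((!) roots) zs. d v (nx v)) + D S j = D (2 ^ k - 1) k"
    using tr by (simp_all only: hk_trace_def)
  have "tl (zs @ [j, B S j]) = tl (zs @ [j]) @ [B S j]"
    by (cases zs) auto
  then have "map (nx(roots ! j := roots ! B S j)) (map ((!) roots) (zs @ [j])) =
      map ((!) roots) (tl ((zs @ [j]) @ [B S j]))"
    using hk_trace_upd(1)[OF tr] nx by (simp del: map_map map_eq_conv)
  moreover have "B S j \<notin> set (zs @ [j])" unfolding set using b(1) bk by simp
  moreover have "set ((zs @ [j]) @ [B S j]) = insert k ({..<k} - set_decode (S - 2 ^ B S j))"
    unfolding set_append[of "zs @ [j]"] set set_decode_remove(2)[OF b(1)]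
    using bk b(1) by auto
  moreover have "hd ((zs @ [j]) @ [B S j]) = k"
    using hd by (cases zs) simp_all
  moreover have "(\<Sum>v\<leftarrow>map ((!) roots) (zs @ [j]). d v ((nx(roots ! j := roots ! B S j)) v)) +
      D (S - 2 ^ B S j) (B S j) = D (2 ^ k - 1) k"
    using hk_trace_upd(2)[OF tr] cost b(2) by (simp add: root_dist_def)
  moreover note dist
  moreover have "S - 2 ^ B S j < 2 ^ k" "B S j \<le> k"
    using S(1) bk by simp_all
  ultimately show "hk_trace (nx(roots ! j := roots ! B S j)) D (S - 2 ^ B S j) (B S j) (zs @ [j])"
    unfolding hk_trace_def by simp
qed

text \<open>For \<open>S = 0\<close> the table value is the cost of the arc back to the depot, so
  the closing link turns the telescoped equation into the cost of the whole cycle.\<close>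

lemma hk_trace_finish:
  assumes tr: "hk_trace nx D S j zs" and row: "hk_row root_dist k D B S" and "length zs = k"
  obtains xs where "linked (nx(roots ! j := first_root)) first_root xs" "set (first_root # xs) = set roots"
    and "path_cost d first_root xs first_root = D (2 ^ k - 1) k"
proof -
  let ?nx = "nx(roots ! j := first_root)"
  have "S = 0"
    using hk_trace_length[OF tr] \<open>length zs = k\<close>
    by (metis add_cancel_right_right card_eq_0_iff finite_set_decode set_decode_inverse set_encode_empty)
  have "j \<le> k" using tr by (simp add: hk_trace_def)
  then have D: "D S j = d (roots ! j) first_root"
    using row \<open>S = 0\<close> by (simp add: hk_row_def hk_best_def root_dist_def)
  obtain ws where ws: "zs @ [j] = k # ws"
    using tr by (cases "zs @ [j]") (auto simp: hk_trace_def)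
  define xs where "xs = map ((!) roots) ws"
  have xs: "map ((!) roots) (zs @ [j]) = first_root # xs"
    by (simp add: ws xs_def)
  have set_ws: "set (k # ws) = {..k}"
  proof -
    have "set (zs @ [j]) = insert k ({..<k} - set_decode S)"
      using tr by (simp only: hk_trace_def)
    also have "\<dots> = {..k}"
      by (simp only: \<open>S = 0\<close> set_decode_zero Diff_empty flip: lessThan_Suc lessThan_Suc_atMost)
    finally show ?thesis by (simp only: ws)
  qed
  have set: "set (first_root # xs) = set roots"
  proof -
    have "set (first_root # xs) = (!) roots ` {..k}"
      unfolding set_ws[symmetric] by (simp add: xs_def)
    also have "\<dots> = set roots"
      using nth_image[of "Suc k" roots] length_roots by (simp add: atLeast0LessThan lessThan_Suc_atMost)
    finally show ?thesis .
  qed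
  have "distinct (k # ws)" using tr by (metis hk_trace_def ws)
  then have "distinct (first_root # xs)"
    using set_ws roots_nth_eq_iff
    unfolding xs_def list.map(2)[symmetric] distinct_map by (auto simp: inj_on_def simp del: list.map)
  moreover have "map ?nx (first_root # xs) = xs @ [first_root]"
  proof -
    have "map ?nx (first_root # xs) = map nx (map ((!) roots) zs) @ [first_root]"
      using hk_trace_upd(1)[OF tr] unfolding xs[symmetric] by simp
    also have "map nx (map ((!) roots) zs) = xs"
      using tr by (simp add: hk_trace_def ws xs_def)
    finally show ?thesis .
  qed
  ultimately have linked: "linked ?nx first_root xs" by (simp only: linked_def)
  have "path_cost d first_root xs first_root = (\<Sum>v\<leftarrow>first_root # xs. d v (?nx v))"
    unfolding linked_cost[OF linked]
    using linked by (subst sum_list_distinct_conv_sum_set) (auto simp: linked_def)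
  also have "\<dots> = D (2 ^ k - 1) k"
    using hk_trace_upd(2)[OF tr] tr D unfolding xs[symmetric] by (simp add: hk_trace_def)
  finally show ?thesis using linked set that by blast
qed

definition best_root_cycle :: "nat list \<Rightarrow> bool" where
  "best_root_cycle xs \<longleftrightarrow> set (first_root # xs) = set roots \<and>
     (\<forall>ys. distinct (first_root # ys) \<longrightarrow> set (first_root # ys) = set roots \<longrightarrow>
        path_cost d first_root xs first_root \<le> path_cost d first_root ys first_root)"

text \<open>Translate the competing cycle to indices: its vertices other than the depot correspond
  bijectively to \<open>{..<k}\<close>, the set coded by \<open>2 ^ k - 1\<close>.\<close>

lemma hk_optimal:
  assumes rows: "\<And>S. S < 2 ^ k \<Longrightarrow> hk_row root_dist k D B S"
    and ys: "distinct (first_root # ys)" "set (first_root # ys) = set roots"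
  shows "D (2 ^ k - 1) k \<le> path_cost d first_root ys first_root"
proof -
  have "\<exists>i<k. roots ! i = y" if "y \<in> set ys" for y
  proof -
    have "y \<in> set roots" "y \<noteq> first_root" using ys that by auto
    then show ?thesis
      using length_roots by (metis in_set_conv_nth less_Suc_eq)
  qed
  then obtain f where f: "\<And>y. y \<in> set ys \<Longrightarrow> f y < k \<and> roots ! f y = y" by metis
  have ys_eq: "map ((!) roots) (map f ys) = ys"
    using f by (simp add: map_idI)
  have dist: "distinct (map f ys)"
    using ys(1) ys_eq by (metis distinct.simps(2) distinct_map)
  have "set (map f ys) = {..<k}"
  proof (rule card_subset_eq)
    have "Suc (length ys) = Suc k"
      using ys distinct_roots length_roots by (metis distinct_card length_Cons)
    then show "card (set (map f ys)) = card {..<k}"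
      using distinct_card[OF dist] by simp
  qed (use f in auto)
  then have "D (2 ^ k - 1) k \<le> path_cost root_dist k (map f ys) k"
    using hk_lower_bound[of k root_dist D B "2 ^ k - 1" k "map f ys", OF rows _ _ dist]
    unfolding set_decode_full by simp
  also have "\<dots> = path_cost d first_root ys first_root"
    using path_cost_map[of d "(!) roots" k "map f ys" k] ys_eq
    by (simp add: root_dist_def[abs_def])
  finally show ?thesis .
qed

lemma wp_link_roots:
  assumes "ready s" and rows: "\<And>S. S < 2 ^ k \<Longrightarrow> hk_row root_dist k (tab (rarr s 1)) (tab (narr s 6)) S"
  shows "wp link_roots (\<lambda>t' s'. t' \<le> t + (10 * k + 7) \<and> ready s' \<and> narr s' 2 = narr s 2 \<and>
    (\<exists>xs. linked (narr s' 7) first_root xs \<and> best_root_cycle xs)) t s"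
proof -
  let ?D = "tab (rarr s 1)" and ?B = "tab (narr s 6)"
  \<comment> \<open>Hides the subset and the visited list, of which the machine keeps only the
    scaled code and the current index.\<close>
  define tr where "tr i nx a j v \<longleftrightarrow>
    (\<exists>S zs. length zs = i \<and> a = S * nroots \<and> v = roots ! j \<and> hk_trace nx ?D S j zs)" for i nx a j v
  have tr_step: "b < k \<and> tr (Suc i) (nx(v := roots ! b)) (a - 2 ^ b * nroots) b (roots ! b)"
    if i: "i < k" and tr: "tr i nx a j v" and b: "b = narr s 6 (a + j)" for i nx a j v b
  proof -
    from tr obtain S zs where zs: "length zs = i" and a: "a = S * nroots" "v = roots ! j"
      and ht: "hk_trace nx ?D S j zs" by (auto simp: tr_def)
    have "S < 2 ^ k" using ht by (simp add: hk_trace_def)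
    note st = hk_trace_step[OF ht rows[OF this]]
    have "?B S j = b" by (simp add: b a tab_def)
    with st i zs have "b < k" "hk_trace (nx(roots ! j := roots ! b)) ?D (S - 2 ^ b) b (zs @ [j])"
      by simp_all
    moreover have "a - 2 ^ b * nroots = (S - 2 ^ b) * nroots"
      by (simp only: a diff_mult_distrib)
    ultimately show ?thesis
      unfolding tr_def using zs a(2) by (intro conjI exI[of _ "S - 2 ^ b"] exI[of _ "zs @ [j]"]) simp_all
  qed
  let ?I = "\<lambda>i s'. ready s' \<and> narr s' 2 = narr s 2 \<and> narr s' 6 = narr s 6 \<and> nreg s' 12 = i \<and>
    tr i (narr s' 7) (nreg s' 6) (nreg s' 7) (nreg s' 9)"
  have step: "eval_test (NLess 12 4) s' \<and> wp link_next (\<lambda>t' s'. t' \<le> t + 9 \<and> ?I (Suc i) s') t s'"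
    if i: "i < k" and I: "?I i s'" for i s' t
  proof -
    define b where "b = narr s 6 (nreg s' 6 + nreg s' 7)"
    have tr: "tr i (narr s' 7) (nreg s' 6) (nreg s' 7) (nreg s' 9)" using I by blast
    have st: "b < k" "tr (Suc i) ((narr s' 7)(nreg s' 9 := roots ! b)) (nreg s' 6 - 2 ^ b * nroots) b (roots ! b)"
      using tr_step[OF i tr b_def] by auto
    have "ready s'" "narr s' 2 = narr s 2" "narr s' 6 = narr s 6" "nreg s' 12 = i" using I by auto
    moreover from this st(1) have "narr s' 5 b = 2 ^ b * nroots" "narr s' 3 b = roots ! b"
      by (simp_all add: ready_def rooted_def)
    ultimately show ?thesis
      using st i by (simp add: link_next_def ready_def rooted_def base_def flip: b_def)
  qed
  \<comment> \<open>Register 5 minus register 3 is the scaled code of the full set.\<close>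
  have L: "2 ^ k * nroots - nroots = (2 ^ k - 1) * nroots"
    by (simp add: diff_mult_distrib)
  have init: "tr 0 (narr s 7) ((2 ^ k - 1) * nroots) k first_root"
    using set_decode_full[of k] by (auto simp: tr_def hk_trace_def)
  have fin: "\<exists>xs. linked ((narr s' 7)(nreg s' 9 := first_root)) first_root xs \<and> best_root_cycle xs"
    if "?I k s'" for s'
  proof -
    from that obtain S j zs where v: "nreg s' 9 = roots ! j" and tr: "hk_trace (narr s' 7) ?D S j zs"
      and "length zs = k" by (auto simp: tr_def)
    have "S < 2 ^ k" using tr by (simp add: hk_trace_def)
    obtain xs where "linked ((narr s' 7)(roots ! j := first_root)) first_root xs"
      "set (first_root # xs) = set roots" "path_cost d first_root xs first_root = ?D (2 ^ k - 1) k"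
      using hk_trace_finish[OF tr rows[OF \<open>S < 2 ^ k\<close>] \<open>length zs = k\<close>] by blast
    then show ?thesis
      using v hk_optimal[OF rows] unfolding best_root_cycle_def by metis
  qed
  show ?thesis
    using assms(1) init L unfolding link_roots_def
    apply (simp add: ready_def rooted_def base_def)
    apply (rule wp_for[where m = k and K = 9 and I = ?I, OF step])
       apply assumption
      apply assumption
     apply (auto simp: ready_def rooted_def base_def)[1]
    apply (auto simp: ready_def rooted_def base_def)[1]
    subgoal for t' s' using fin[of s'] by (auto simp: ready_def rooted_def base_def)
    done
qed

section \<open>Inserting the remaining vertices\<close>

definition pending_cost :: "(nat \<Rightarrow> nat) \<Rightarrow> real" where
  "pending_cost p = (\<Sum>v | v < n \<and> p v \<noteq> 0. d (par v - 1) v)"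

text \<open>An amortised bound: every pending vertex holds twice the cost of its parent arc as
  credit, which pays for its insertion, so \<open>x\<close> stays the same throughout.\<close>

definition partial_tour :: "(nat \<Rightarrow> nat) \<Rightarrow> (nat \<Rightarrow> nat) \<Rightarrow> real \<Rightarrow> bool" where
  "partial_tour nx p x \<longleftrightarrow>
     (\<exists>xs. linked nx first_root xs \<and> set (first_root # xs) = {v. v < n \<and> p v = 0}) \<and>
     (\<forall>v<n. p v = 0 \<or> p v = par v) \<and>
     (\<Sum>v | v < n \<and> p v = 0. d v (nx v)) + 2 * pending_cost p \<le> x"

lemma partial_tour_insert:
  assumes pt: "partial_tour nx p x" and v: "v < n" "p v = Suc u" "p u = 0"
  shows "partial_tour (nx(v := nx u, u := v)) (p(v := 0)) x"
proof -
  obtain xs where lk: "linked nx first_root xs" and set: "set (first_root # xs) = {v. v < n \<and> p v = 0}"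
    and p: "\<forall>v<n. p v = 0 \<or> p v = par v"
    and cost: "(\<Sum>v | v < n \<and> p v = 0. d v (nx v)) + 2 * pending_cost p \<le> x"
    using pt by (auto simp only: partial_tour_def)
  have par_v: "par v = Suc u" using p v by force
  have u: "u < n" "d v u \<le> d u v" using par[OF v(1) par_v] by auto
  let ?S = "{v. v < n \<and> p v = 0}" and ?P = "{v. v < n \<and> p v \<noteq> 0}"
  have uv: "u \<in> ?S" "v \<notin> ?S" using u v by auto
  have S': "{w. w < n \<and> (p(v := 0)) w = 0} = insert v ?S" using v by auto
  have P': "{w. w < n \<and> (p(v := 0)) w \<noteq> 0} = ?P - {v}" by auto
  obtain ys where "linked (nx(v := nx u, u := v)) first_root ys" "set (first_root # ys) = insert v ?S"
    using linked_insert[OF lk, of u v] uv unfolding set by blast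
  moreover have "pending_cost p = d u v + pending_cost (p(v := 0))"
    unfolding pending_cost_def P' using v par_v by (subst sum.remove[of ?P v]) auto
  moreover have "(\<Sum>w\<in>insert v ?S. d w ((nx(v := nx u, u := v)) w)) =
      (\<Sum>w\<in>?S. d w (nx w)) - d u (nx u) + d u v + d v (nx u)"
    by (rule linked_insert_cost[OF _ uv]) simp
  moreover have "d v (nx u) \<le> d v u + d u (nx u)"
  proof (rule tri[OF v(1) u(1)])
    have "nx u \<in> set (map nx (first_root # xs))"
      using uv(1) unfolding set[symmetric] by (simp only: set_map imageI)
    also have "\<dots> = {v. v < n \<and> p v = 0}"
      using lk set by (simp add: linked_def)
    finally show "nx u < n" by simp
  qed
  moreover have "\<forall>w<n. (p(v := 0)) w = 0 \<or> (p(v := 0)) w = par w" using p by simp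
  ultimately show ?thesis
    unfolding partial_tour_def S' using cost u(2) by (intro conjI) (blast, assumption, linarith)
qed

text \<open>Progress in the lexicographic order of depth and vertex number. Sweep \<open>l\<close>
  guarantees depth \<open>l\<close>; deeper vertices may happen to be inserted early.\<close>

definition inserted_upto :: "(nat \<Rightarrow> nat) \<Rightarrow> nat \<Rightarrow> nat \<Rightarrow> bool" where
  "inserted_upto p l v \<longleftrightarrow> (\<forall>w<n. dep w < l \<or> w < v \<and> dep w = l \<longrightarrow> p w = 0)"

lemma wp_insert_round:
  assumes "ready s" "partial_tour (narr s 7) (narr s 2) x" "inserted_upto (narr s 2) l 0" "nreg s 6 = l"
  shows "wp insert_round (\<lambda>t' s'. t' \<le> t + (11 * n + 3) \<and> ready s' \<and> nreg s' 6 = Suc l \<and>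
    partial_tour (narr s' 7) (narr s' 2) x \<and> inserted_upto (narr s' 2) (Suc l) 0) t s"
proof -
  let ?I = "\<lambda>v s'. ready s' \<and> nreg s' 6 = l \<and> nreg s' 7 = v \<and>
    partial_tour (narr s' 7) (narr s' 2) x \<and> inserted_upto (narr s' 2) l v"
  have step: "eval_test (NLess 7 0) s' \<and> wp insert_vertex (\<lambda>t' s'. t' \<le> t + 10 \<and> ?I (Suc v) s') t s'"
    if v: "v < n" and I: "?I v s'" for v s' t
  proof -
    let ?p = "narr s' 2" and ?nx = "narr s' 7"
    have regs: "nreg s' 0 = n" "nreg s' 1 = 1" "nreg s' 2 = 0" "nreg s' 6 = l" "nreg s' 7 = v" "ready s'"
      and pt: "partial_tour ?nx ?p x" and up: "inserted_upto ?p l v"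
      using I by (simp_all add: ready_def rooted_def base_def)
    have keep: "inserted_upto ?p l (Suc v)" if "?p v = 0 \<or> l < dep v"
      using up that by (auto simp: inserted_upto_def less_Suc_eq)
    show ?thesis
    proof (cases "?p v")
      case 0
      then show ?thesis
        using regs pt v keep by (simp add: insert_vertex_def ready_def rooted_def base_def)
    next
      case (Suc u)
      have "par v = Suc u" using pt Suc v by (force simp: partial_tour_def)
      then have u: "u < n" "dep u < dep v" using par[OF v] by auto
      show ?thesis
      proof (cases "?p u = 0")
        case True
        have "inserted_upto (?p(v := 0)) l (Suc v)"
          using up by (auto simp: inserted_upto_def less_Suc_eq)
        then show ?thesis
          using regs v Suc True partial_tour_insert[OF pt v Suc True]
          by (simp add: insert_vertex_def ready_def rooted_def base_def)
      next
        case False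
        \<comment> \<open>A parent that is still pending has depth at least \<open>l\<close>, so
          \<open>v\<close> lies deeper and is not due in this sweep.\<close>
        then have "l \<le> dep u" using up u by (auto simp: inserted_upto_def not_less[symmetric])
        then show ?thesis
          using regs pt v Suc False u keep by (simp add: insert_vertex_def ready_def rooted_def base_def)
      qed
    qed
  qed
  have fin: "inserted_upto p (Suc l) 0" if "inserted_upto p l n" for p
    using that by (auto simp: inserted_upto_def less_Suc_eq)
  show ?thesis
    using assms unfolding insert_round_def
    apply (simp add: ready_def rooted_def base_def)
    apply (rule wp_for[where m = n and K = 10 and I = ?I, OF step])
       apply assumption
      apply assumption
     apply (auto simp: ready_def rooted_def base_def)[1]
    apply (auto simp: ready_def rooted_def base_def)[1]
    subgoal for t' s' using fin[of "narr s' 2"] by (auto simp: ready_def rooted_def base_def)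
    done
qed

lemma wp_insert_vertices:
  assumes "ready s" "partial_tour (narr s 7) (narr s 2) x"
  shows "wp insert_vertices (\<lambda>t' s'. t' \<le> t + (n * Suc (11 * n + 3) + 2) \<and> ready s' \<and>
    (\<exists>xs. linked (narr s' 7) first_root xs \<and> set (first_root # xs) = {..<n} \<and>
      path_cost d first_root xs first_root \<le> x)) t s"
proof -
  let ?I = "\<lambda>l s'. ready s' \<and> nreg s' 6 = l \<and>
    partial_tour (narr s' 7) (narr s' 2) x \<and> inserted_upto (narr s' 2) l 0"
  have step: "eval_test (NLess 6 0) s' \<and> wp insert_round (\<lambda>t' s'. t' \<le> t + (11 * n + 3) \<and> ?I (Suc l) s') t s'"
    if "l < n" "?I l s'" for l s' t
  proof
    show "eval_test (NLess 6 0) s'" using that by (simp add: ready_def rooted_def base_def)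
    show "wp insert_round (\<lambda>t' s'. t' \<le> t + (11 * n + 3) \<and> ?I (Suc l) s') t s'"
      using that by (intro wp_mono[OF wp_insert_round[of s' x l]]) simp_all
  qed
  have fin: "\<exists>xs. linked nx first_root xs \<and> set (first_root # xs) = {..<n} \<and>
      path_cost d first_root xs first_root \<le> x"
    if pt: "partial_tour nx p x" and up: "inserted_upto p n 0" for nx p
  proof -
    have "p v = 0" if "v < n" for v
      using up dep[OF that] that by (simp add: inserted_upto_def)
    then have all: "{v. v < n \<and> p v = 0} = {..<n}" "{v. v < n \<and> p v \<noteq> 0} = {}"
      by auto
    then have "pending_cost p = 0" by (simp only: pending_cost_def sum.empty)
    with all(1)
    obtain xs where xs: "linked nx first_root xs" "set (first_root # xs) = {..<n}"
      and "(\<Sum>v<n. d v (nx v)) \<le> x"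
      using pt unfolding partial_tour_def by auto
    moreover have "path_cost d first_root xs first_root = (\<Sum>v<n. d v (nx v))"
      using linked_cost[OF xs(1), of d] unfolding xs(2) .
    ultimately show ?thesis by (intro exI[of _ xs]) simp
  qed
  show ?thesis
    using assms unfolding insert_vertices_def
    apply (simp add: ready_def rooted_def base_def)
    apply (rule wp_for[where m = n and K = "11 * n + 3" and I = ?I, OF step])
       apply assumption
      apply assumption
     apply (auto simp: ready_def rooted_def base_def)[1]
    apply (auto simp: ready_def rooted_def base_def inserted_upto_def)[1]
    subgoal for t' s' using fin[of "narr s' 7" "narr s' 2"] by (auto simp: ready_def rooted_def base_def)
    done
qed

section \<open>Output\<close>

lemma wp_write_tour:
  assumes "ready s" "linked (narr s 7) first_root xs" "set (first_root # xs) = {..<n}"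
  shows "wp write_tour (\<lambda>t' s'. t' \<le> t + (4 * n + 3) \<and>
    map (narr s' 1) [0..<n] = first_root # xs) t s"
proof -
  let ?I = "\<lambda>i s'. ready s' \<and> narr s' 7 = narr s 7 \<and> nreg s' 6 = i \<and>
    nreg s' 10 = (narr s 7 ^^ i) first_root \<and> (\<forall>j<i. narr s' 1 j = (narr s 7 ^^ j) first_root)"
  have step: "eval_test (NLess 6 0) s' \<and> wp write_vertex (\<lambda>t' s'. t' \<le> t + 3 \<and> ?I (Suc i) s') t s'"
    if "i < n" "?I i s'" for i s' t
    using that by (auto simp: write_vertex_def ready_def rooted_def base_def less_Suc_eq)
  have "distinct (first_root # xs)" using assms(2) by (simp only: linked_def)
  then have len: "length (first_root # xs) = n"
    using assms(3) by (metis card_lessThan distinct_card)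
  have fin: "map a [0..<n] = first_root # xs" if "\<forall>j<n. a j = (narr s 7 ^^ j) first_root" for a
    using that len linked_nth[OF assms(2)] by (intro nth_equalityI) auto
  show ?thesis
    using assms(1) unfolding write_tour_def
    apply (simp add: ready_def rooted_def base_def)
    apply (rule wp_for[where m = n and K = 3 and I = ?I, OF step])
       apply assumption
      apply assumption
     apply (auto simp: ready_def rooted_def base_def)[1]
    apply (auto simp: ready_def rooted_def base_def)[1]
    subgoal for t' s' using fin[of "narr s' 1"] by (auto simp: ready_def rooted_def base_def)
    done
qed

section \<open>Running time\<close>

definition running_time :: nat where
  "running_time = (n * Suc (10 * n + 10) + 2) + (9 * n + 5) + (4 * k + 4) +
     (2 ^ k * Suc (Suc k * Suc (16 * k + 12) + 4) + 2) + (10 * k + 7) +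
     (n * Suc (11 * n + 3) + 2) + (4 * n + 3)"

lemma k_less: "k < n"
proof -
  have "length roots \<le> n" using length_filter_le[of _ "[0..<n]"] by (simp add: roots_def)
  then show ?thesis by (simp add: length_roots)
qed

text \<open>The polynomial phases take at most 21 + 28 + 14 + 25 = 88 times n^2 steps. For k \<ge> 1
  the table costs at most 16 + 29 + 18 = 63 times 2^k k^2; for k = 0 it costs 18, which is charged
  to n^2. Hence 106 = 88 + 18.\<close>

lemma running_time_le: "running_time \<le> 106 * (2 ^ k * k\<^sup>2 + n\<^sup>2)"
proof -
  have "n \<le> n\<^sup>2" by (simp add: power2_eq_square)
  with k_less n_pos have "k \<le> n\<^sup>2" "1 \<le> n\<^sup>2" by linarith+
  have "(n * Suc (10 * n + 10) + 2) + (9 * n + 5) + (4 * k + 4) + 2 + (10 * k + 7) +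
      (n * Suc (11 * n + 3) + 2) + (4 * n + 3) = 21 * n\<^sup>2 + 28 * n + 14 * k + 25"
    by (simp add: power2_eq_square algebra_simps)
  also have "\<dots> \<le> 88 * n\<^sup>2"
    using \<open>n \<le> n\<^sup>2\<close> \<open>k \<le> n\<^sup>2\<close> \<open>1 \<le> n\<^sup>2\<close> by linarith
  finally have rest: "(n * Suc (10 * n + 10) + 2) + (9 * n + 5) + (4 * k + 4) + 2 + (10 * k + 7) +
      (n * Suc (11 * n + 3) + 2) + (4 * n + 3) \<le> 88 * n\<^sup>2" .
  have "2 ^ k * Suc (Suc k * Suc (16 * k + 12) + 4) \<le> 63 * (2 ^ k * k\<^sup>2) + 18 * n\<^sup>2"
  proof (cases "k = 0")
    case True
    with \<open>1 \<le> n\<^sup>2\<close> show ?thesis by simp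
  next
    case False
    then have "k \<le> k\<^sup>2" "1 \<le> k\<^sup>2" by (auto simp: power2_eq_square)
    moreover have "Suc (Suc k * Suc (16 * k + 12) + 4) = 16 * k\<^sup>2 + 29 * k + 18"
      by (simp add: power2_eq_square algebra_simps)
    ultimately have "Suc (Suc k * Suc (16 * k + 12) + 4) \<le> 63 * k\<^sup>2" by linarith
    then have "2 ^ k * Suc (Suc k * Suc (16 * k + 12) + 4) \<le> 2 ^ k * (63 * k\<^sup>2)"
      by (rule mult_le_mono2)
    also have "\<dots> = 63 * (2 ^ k * k\<^sup>2)" by simp
    finally show ?thesis by linarith
  qed
  with rest show ?thesis
    unfolding running_time_def distrib_left by linarith
qed

lemma partial_tour_roots:
  assumes "linked nx first_root rs" "best_root_cycle rs"
  shows "partial_tour nx pars (path_cost d first_root rs first_root + 2 * pending_cost pars)"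
proof -
  have set: "set (first_root # rs) = {v. v < n \<and> pars v = 0}"
    using assms(2) set_roots by (auto simp: best_root_cycle_def pars_def)
  show ?thesis
    unfolding partial_tour_def
  proof (intro conjI)
    show "\<exists>xs. linked nx first_root xs \<and> set (first_root # xs) = {v. v < n \<and> pars v = 0}"
      using assms(1) set by blast
    show "(\<Sum>v | v < n \<and> pars v = 0. d v (nx v)) + 2 * pending_cost pars
        \<le> path_cost d first_root rs first_root + 2 * pending_cost pars"
      using linked_cost[OF assms(1), of d] unfolding set by simp
  qed (simp add: pars_def)
qed

lemma wp_atsp_program:
  assumes "nreg s 0 = n" "nreg s 2 = 0" "nreg s 3 = 0" "nreg s 6 = 0" "nreg s 8 = 0" "narr s 2 = (\<lambda>_. 0)"
    and "\<And>u v. u < n \<Longrightarrow> v < n \<Longrightarrow> rarr s 0 (u * n + v) = d u v"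
    and "\<And>u v. u < n \<Longrightarrow> v < n \<Longrightarrow>
      narr s 0 (u * n + v) = 1 \<and> \<not> d u v < d v u \<longleftrightarrow> par v = Suc u"
  shows "wp atsp_program (\<lambda>t' s'. t' \<le> t + running_time \<and>
    (\<exists>xs rs. map (narr s' 1) [0..<n] = first_root # xs \<and> distinct (first_root # xs) \<and>
      set (first_root # xs) = {..<n} \<and> best_root_cycle rs \<and>
      path_cost d first_root xs first_root \<le> path_cost d first_root rs first_root + 2 * pending_cost pars)) t s"
  unfolding atsp_program_def block.simps wp_Seq
  apply (rule wp_mono[OF wp_find_parents[OF assms]], assumption+)
  apply (elim conjE)
  apply (rule wp_mono[OF wp_collect_roots], assumption+)
  apply (elim conjE)
  apply (rule wp_mono[OF wp_powers], assumption+)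
  apply (elim conjE)
  apply (rule wp_mono[OF wp_held_karp], assumption+)
  apply (elim conjE)
  apply (rule wp_mono[OF wp_link_roots], assumption+)
   apply blast
  apply (elim conjE exE)
  subgoal for t1 s1 t2 s2 t3 s3 t4 s4 t5 s5 rs
    apply (rule wp_mono[OF wp_insert_vertices[where x = "path_cost d first_root rs first_root + 2 * pending_cost pars"]])
      apply assumption
     apply (simp add: partial_tour_roots)
    apply (elim conjE exE)
    subgoal for t6 s6 xs
      apply (rule wp_mono[OF wp_write_tour], assumption+)
      apply (intro conjI)
       apply (simp add: running_time_def)
      apply (rule exI[of _ xs], rule exI[of _ rs])
      apply (auto simp: linked_def)
      done
    done
  done

end

theorem theorem4p2:
  shows "\<exists>(P :: com) (C :: nat). \<forall>(n :: nat) (G :: nat pair_pre_digraph)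
      (c :: (nat \<times> nat) weight_fun) (A :: nat pair_pre_digraph) (k :: nat).
    n \<ge> 2 \<longrightarrow> metric_atsp n G c \<longrightarrow> min_spanning_arborescence A G c \<longrightarrow>
    k = card (one_way_arcs c A) \<longrightarrow>
    (\<exists>t s. exec P (input_state n G c A) t s \<and>
       t \<le> C * (2 ^ k * k\<^sup>2 + n\<^sup>2) \<and>
       tour G (output_tour n s) \<and>
       wf_digraph.awalk_cost c (output_tour n s) \<le> 3 * opt_cost G c)"
proof (rule exI[of _ atsp_program], rule exI[of _ 106], intro allI impI)
  fix n :: nat and G :: "nat pair_pre_digraph" and c :: "(nat \<times> nat) weight_fun"
    and A :: "nat pair_pre_digraph" and k :: nat
  assume n: "2 \<le> n" and G: "metric_atsp n G c" and A: "min_spanning_arborescence A G c"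
    and k: "k = card (one_way_arcs c A)"
  let ?d = "arc_cost n c" and ?par = "parent_code c A" and ?s = "input_state n G c A"
  obtain dep where "rooted_forest n ?d ?par dep"
    and roots: "card {v. v < n \<and> ?par v = 0} = Suc (card (one_way_arcs c A))"
    and kept: "\<And>u v. kept_arc c A u v \<longleftrightarrow> ?par v = Suc u"
    and pending: "(\<Sum>v | v < n \<and> ?par v \<noteq> 0. ?d (?par v - 1) v) \<le> sum c (parcs A)"
    by (rule kept_forest[OF G A]) (rule that; assumption)
  then interpret F: rooted_forest n ?d ?par dep by simp
  have "card (set F.roots) = Suc F.k"
    by (simp only: distinct_card[OF F.distinct_roots] F.length_roots)
  then have Fk: "F.k = k" using roots k by (simp add: F.set_roots)
  have "parcs A \<subseteq> parcs G"
    using A by (auto simp: min_spanning_arborescence_def spanning_arborescence_def spanning_def subgraph_def)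
  then have AG: "u < n \<and> v < n \<and> u \<noteq> v" if "(u, v) \<in> parcs A" for u v
    using that metric_atspD(2)[OF G] by auto
  have index: "u * n + v < n * n" "(u * n + v) div n = u" "(u * n + v) mod n = v" if "u < n" "v < n" for u v
  proof -
    have "u * n + v < Suc u * n" using that by simp
    also have "\<dots> \<le> n * n" using that(1) by (intro mult_le_mono1) simp
    finally show "u * n + v < n * n" .
  qed (use that in simp_all)
  have costs: "rarr ?s 0 (u * n + v) = ?d u v" if "u < n" "v < n" for u v
    using index[OF that] that metric_atspD(2)[OF G] by (simp add: input_state_def arc_cost_def)
  have arcs: "narr ?s 0 (u * n + v) = 1 \<and> \<not> ?d u v < ?d v u \<longleftrightarrow> ?par v = Suc u"
    if "u < n" "v < n" for u v
    using index[OF that] that AG[of u v] unfolding kept[symmetric]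
    by (auto simp: input_state_def arc_cost_def kept_arc_def)
  have "wp atsp_program (\<lambda>t' s'. t' \<le> 0 + F.running_time \<and>
    (\<exists>xs rs. map (narr s' 1) [0..<n] = F.first_root # xs \<and> distinct (F.first_root # xs) \<and>
      set (F.first_root # xs) = {..<n} \<and> F.best_root_cycle rs \<and>
      path_cost ?d F.first_root xs F.first_root \<le>
        path_cost ?d F.first_root rs F.first_root + 2 * F.pending_cost F.pars)) 0 ?s"
    by (rule F.wp_atsp_program) (simp_all add: costs arcs[simplified], simp_all add: input_state_def)
  then obtain t s xs rs where ex: "exec atsp_program ?s t s" and t: "t \<le> F.running_time"
    and out: "map (narr s 1) [0..<n] = F.first_root # xs"
    and xs: "distinct (F.first_root # xs)" "set (F.first_root # xs) = {..<n}"
    and rs: "F.best_root_cycle rs"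
    and cost: "path_cost ?d F.first_root xs F.first_root \<le>
        path_cost ?d F.first_root rs F.first_root + 2 * F.pending_cost F.pars"
    unfolding wp_def by auto
  have out_eq: "output_tour n s = zip (F.first_root # xs) (xs @ [F.first_root])"
    unfolding output_tour_def Let_def out by simp
  note tour = tour_of_list[OF G n xs, folded out_eq]
  obtain q where q: "tour G q" "opt_cost G c = wf_digraph.awalk_cost c q"
    by (rule opt_cost_attained[OF G tour(1)]) (rule that)
  have r: "F.first_root < n" "F.first_root \<in> set F.roots"
    using F.root_less F.length_roots by simp_all
  obtain ys where ys: "distinct (F.first_root # ys)" "set (F.first_root # ys) = {..<n}"
    and q_cost: "wf_digraph.awalk_cost c q = path_cost ?d F.first_root ys F.first_root"
    by (rule tour_vertices[OF G q(1) r(1)]) (rule that)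
  \<comment> \<open>\<open>first_root\<close> is itself a root and survives as base point, so the
    filtered tour is one of the cycles with which \<open>rs\<close> is compared in
    \<open>best_root_cycle\<close>.\<close>
  let ?zs = "filter (\<lambda>v. ?par v = 0) ys"
  have "set (F.first_root # ?zs) = {v \<in> set (F.first_root # ys). ?par v = 0}"
    using r(2) by (auto simp: F.set_roots)
  also have "\<dots> = set F.roots" unfolding ys(2) F.set_roots by auto
  finally have "path_cost ?d F.first_root rs F.first_root \<le> path_cost ?d F.first_root ?zs F.first_root"
    using rs ys(1) unfolding F.best_root_cycle_def by auto
  also have "\<dots> \<le> path_cost ?d F.first_root ys F.first_root"
    using metric_atspD(7)[OF G] r(1) ys(2) by (intro path_cost_filter[where V = "{..<n}"]) auto
  finally have "path_cost ?d F.first_root rs F.first_root \<le> opt_cost G c"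
    by (simp only: q(2) q_cost)
  moreover have "F.pending_cost F.pars = (\<Sum>v | v < n \<and> ?par v \<noteq> 0. ?d (?par v - 1) v)"
    unfolding F.pending_cost_def by (intro sum.cong) (auto simp: F.pars_def)
  then have "F.pending_cost F.pars \<le> opt_cost G c"
    using pending min_arborescence_le[OF G A ys] by (simp only: q(2) q_cost)
  ultimately have "wf_digraph.awalk_cost c (output_tour n s) \<le> 3 * opt_cost G c"
    using cost tour(2) by linarith
  moreover have "t \<le> 106 * (2 ^ k * k\<^sup>2 + n\<^sup>2)"
    using t F.running_time_le unfolding Fk by simp
  ultimately show "\<exists>t s. exec atsp_program ?s t s \<and> t \<le> 106 * (2 ^ k * k\<^sup>2 + n\<^sup>2) \<and>
      tour G (output_tour n s) \<and> wf_digraph.awalk_cost c (output_tour n s) \<le> 3 * opt_cost G c"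
    using ex tour(1) by blast
qed

end
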